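(* Let $p>2$ be a prime. For each integer $\lambda\ge 1$ and for each finite abelian $p$-group $P$ there exists a commutative local artinian ring $A$ such that $$A^*\cong\mathbb F_{p^\lambda}^*\times P^\lambda.$$
   Context: $A^*$ denotes the group of units of a ring $A$ (rings have $1$), $\mathbb F_q$ is the finite field with $q$ elements, and $P^\lambda$ is the direct product of $\lambda$ copies of $P$. *)

theory Defs
  imports
    "HOL-Algebra.Algebraic_Closure"
    "HOL-Algebra.Product_Groups"
    "HOL-Computational_Algebra.Primes"
    "HOL-Number_Theory.Residues"
begin

locale local_ring = cring +
  assumes unique_maximal: "\<exists>!M. maximalideal M R"

text \<open>Two-sided ideals are used in the chain condition, so the notion is restricted to
  commutative rings.\<close>

locale artinian_ring = cring +
  assumes descending_chain:
    "\<lbrakk>\<And>n. ideal (I n) R; \<And>n. I (Suc n) \<subseteq> I n\<rbrakk> \<Longrightarrow> \<exists>N::nat. \<forall>n\<ge>N. I n = I N"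

text \<open>The finite field with \<open>q\<close> elements, up to isomorphism. For \<open>q\<close> not a prime power \<open>GF q\<close>
  is unspecified; that it is a field with \<open>q\<close> elements for every prime power is lemma
  \<open>GF_prime_power\<close> below.\<close>

definition GF :: "nat \<Rightarrow> nat ring" where
  "GF q = (SOME F. field F \<and> order F = q)"

lemma (in cring) binomial_cring:
  assumes [simp]: "x \<in> carrier R" "y \<in> carrier R"
  shows "(x \<oplus> y) [^] (n::nat) = (\<Oplus>k\<in>{..n}. [(n choose k)] \<cdot> (x [^] k \<otimes> y [^] (n - k)))"
proof (induction n)
  case 0
  then show ?case by simp
next
  case (Suc n)
  let ?B = "\<Oplus>k\<in>{..n}. [(n choose k)] \<cdot> (x [^] k \<otimes> y [^] (n - k))"
  let ?S = "\<Oplus>k\<in>{..n}. [(n choose k)] \<cdot> (x [^] Suc k \<otimes> y [^] (n - k))"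
  let ?T = "\<Oplus>k\<in>{..n}. [(n choose Suc k)] \<cdot> (x [^] Suc k \<otimes> y [^] (n - k))"
  have "x \<otimes> ?B = (\<Oplus>k\<in>{..n}. x \<otimes> ([(n choose k)] \<cdot> (x [^] k \<otimes> y [^] (n - k))))"
    by (rule finsum_rdistr) auto
  also have "\<dots> = ?S"
    by (rule finsum_cong') (auto simp: add_pow_rdistr m_ac)
  finally have 1: "x \<otimes> ?B = ?S" .
  have "y \<otimes> ?B = (\<Oplus>k\<in>{..n}. y \<otimes> ([(n choose k)] \<cdot> (x [^] k \<otimes> y [^] (n - k))))"
    by (rule finsum_rdistr) auto
  also have "\<dots> = (\<Oplus>k\<in>{..n}. [(n choose k)] \<cdot> (x [^] k \<otimes> y [^] (Suc n - k)))"
    by (rule finsum_cong') (auto simp: add_pow_rdistr m_ac Suc_diff_le)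
  also have "\<dots> = (\<Oplus>k\<in>{..Suc n}. [(n choose k)] \<cdot> (x [^] k \<otimes> y [^] (Suc n - k)))"
    by (subst finsum_Suc) (auto simp: binomial_eq_0)
  also have "\<dots> = ?T \<oplus> y [^] Suc n"
    by (subst finsum_Suc2) auto
  finally have 2: "y \<otimes> ?B = ?T \<oplus> y [^] Suc n" .
  have "(\<Oplus>k\<in>{..Suc n}. [(Suc n choose k)] \<cdot> (x [^] k \<otimes> y [^] (Suc n - k)))
      = (\<Oplus>k\<in>{..n}. [(Suc n choose Suc k)] \<cdot> (x [^] Suc k \<otimes> y [^] (n - k))) \<oplus> y [^] Suc n"
    by (subst finsum_Suc2) auto
  also have "(\<Oplus>k\<in>{..n}. [(Suc n choose Suc k)] \<cdot> (x [^] Suc k \<otimes> y [^] (n - k)))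
      = (\<Oplus>k\<in>{..n}. [(n choose k)] \<cdot> (x [^] Suc k \<otimes> y [^] (n - k)) \<oplus>
           [(n choose Suc k)] \<cdot> (x [^] Suc k \<otimes> y [^] (n - k)))"
    by (rule finsum_cong') (auto simp: add.nat_pow_mult[symmetric])
  also have "\<dots> = ?S \<oplus> ?T"
    by (rule finsum_addf) auto
  also have "?S \<oplus> ?T \<oplus> y [^] Suc n = x \<otimes> ?B \<oplus> y \<otimes> ?B"
    unfolding 1 2 by (rule a_assoc) (auto intro!: finsum_closed)
  also have "\<dots> = (x \<oplus> y) [^] Suc n"
    using Suc by (simp add: l_distr m_comm[of _ "x \<oplus> y"])
  finally show ?case by simp
qed

lemma (in cring) frobenius_add:
  fixes p :: nat
  assumes p: "Factorial_Ring.prime p" "[p] \<cdot> \<one> = \<zero>" and [simp]: "x \<in> carrier R" "y \<in> carrier R"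
  shows "(x \<oplus> y) [^] (p ^ n) = x [^] (p ^ n) \<oplus> y [^] (p ^ n)"
proof (induction n)
  case (Suc n)
  have char: "[k] \<cdot> z = \<zero>" if "p dvd k" "z \<in> carrier R" for z k
  proof -
    obtain m where "k = p * m" using \<open>p dvd k\<close> by blast
    have "[p] \<cdot> z = [p] \<cdot> \<one> \<otimes> z" using that by (subst add_pow_ldistr) auto
    then have "[p] \<cdot> z = \<zero>" using p that by simp
    moreover have "[k] \<cdot> z = [m] \<cdot> ([p] \<cdot> z)"
      using that \<open>k = p * m\<close> by (simp add: add.nat_pow_pow)
    ultimately show ?thesis by simp
  qed
  have step: "(a \<oplus> b) [^] p = a [^] p \<oplus> b [^] p" if [simp]: "a \<in> carrier R" "b \<in> carrier R" for a b
  proof -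
    obtain r where r: "p = Suc r" "r > 0" using prime_gt_1_nat[OF p(1)] by (cases p) auto
    let ?f = "\<lambda>k. [(p choose k)] \<cdot> (a [^] k \<otimes> b [^] (p - k))"
    have z: "(\<Oplus>k\<in>{..r - 1}. ?f (Suc k)) = \<zero>"
    proof -
      have "(\<Oplus>k\<in>{..r - 1}. ?f (Suc k)) = (\<Oplus>k\<in>{..r - 1}. \<zero>)"
      proof (rule finsum_cong')
        fix k assume "k \<in> {..r - 1}"
        then have "p dvd p choose Suc k"
          using p(1) r by (intro dvd_choose_prime) auto
        then show "?f (Suc k) = \<zero>" by (rule char) auto
      qed auto
      then show ?thesis by simp
    qed
    have "(a \<oplus> b) [^] p = (\<Oplus>k\<in>{..Suc r}. ?f k)"
      using binomial_cring[of a b p] r by simp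
    also have "\<dots> = ?f (Suc r) \<oplus> (\<Oplus>k\<in>{..Suc (r - 1)}. ?f k)"
      using r by (subst finsum_Suc) auto
    also have "(\<Oplus>k\<in>{..Suc (r - 1)}. ?f k) = (\<Oplus>k\<in>{..r - 1}. ?f (Suc k)) \<oplus> ?f 0"
      by (subst finsum_Suc2) auto
    finally show ?thesis using z r by simp
  qed
  have "(x \<oplus> y) [^] (p ^ Suc n) = ((x \<oplus> y) [^] (p ^ n)) [^] p"
    by (simp add: nat_pow_pow mult.commute)
  also have "\<dots> = (x [^] (p ^ n)) [^] p \<oplus> (y [^] (p ^ n)) [^] p"
    by (simp add: Suc step)
  finally show ?case by (simp add: nat_pow_pow mult.commute)
qed auto

text \<open>The roots of \<open>X ^ q - X\<close> form the required subfield. Every root \<open>a\<close> is simple because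
  \<open>X ^ q - X = (X - a) ^ q - (X - a)\<close> in characteristic \<open>p\<close>.\<close>

lemma (in field) ex_subfield_of_order:
  fixes p :: nat
  assumes p: "Factorial_Ring.prime p" "[p] \<cdot> \<one> = \<zero>" and "n > 0"
    and K: "subring K R" and split: "\<And>f. f \<in> carrier (K[X]) \<Longrightarrow> splitted f"
  shows "\<exists>F. subfield F R \<and> card F = p ^ n"
proof -
  define q where "q = p ^ n"
  have q: "q > 1"
    unfolding q_def using prime_gt_1_nat[OF p(1)] \<open>n > 0\<close> by (rule one_less_power)
  let ?U = "poly_ring R"
  interpret UK: cring "K[X]" using univ_poly_is_cring[OF K] .
  interpret U: domain "poly_ring R" using univ_poly_is_domain[OF carrier_is_subring] .
  have X: "X \<in> carrier ?U" and XK: "X \<in> carrier (K[X])"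
    using var_closed(1)[OF carrier_is_subring] var_closed(1)[OF K] by auto
  define f where "f = X [^]\<^bsub>K[X]\<^esub> q \<ominus>\<^bsub>K[X]\<^esub> X"
  have fU: "f = X [^]\<^bsub>?U\<^esub> q \<ominus>\<^bsub>?U\<^esub> X"
    unfolding f_def univ_poly_a_minus_consistent[OF K XK]
      unitary_monom_eq_var_pow[OF K, symmetric]
      unitary_monom_eq_var_pow[OF carrier_is_subring, symmetric] ..
  have fc: "f \<in> carrier ?U" unfolding fU using X by simp
  have spl: "splitted f" by (rule split) (simp add: f_def XK)
  have deg: "degree f = q"
  proof -
    have m: "polynomial (carrier R) (monom \<one> q)"
      by (rule monom_is_polynomial[OF carrier_is_subring]) auto
    have neg: "\<ominus>\<^bsub>?U\<^esub> X = [\<ominus> \<one>, \<zero>]"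
      using univ_poly_a_inv_def'[OF carrier_is_subring X] by (simp add: var_def)
    have "f = poly_add (monom \<one> q) [\<ominus> \<one>, \<zero>]"
      unfolding fU a_minus_def neg univ_poly_add
        unitary_monom_eq_var_pow[OF carrier_is_subring, symmetric] ..
    moreover have "polynomial (carrier R) [\<ominus> \<one>, \<zero>]"
      by (auto simp: polynomial_def)
    moreover have "degree (monom \<one> q) = q" by (simp add: monom_def)
    ultimately show ?thesis
      using poly_add_degree_eq[OF carrier_is_subring m, of "[\<ominus> \<one>, \<zero>]"] q by simp
  qed
  have f0: "f \<noteq> []" using deg q by auto
  have hom: "(\<lambda>g. eval g a) \<in> ring_hom ?U R" if "a \<in> carrier R" for a
    using eval_is_hom[OF carrier_is_subring that] .
  have evf: "eval f a = a [^] q \<ominus> a" if a: "a \<in> carrier R" for a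
  proof -
    interpret h: ring_hom_ring ?U R "\<lambda>g. eval g a"
      using hom[OF a] U.ring_axioms ring_axioms by (intro ring_hom_ringI2)
    show ?thesis unfolding fU using X a
      by (simp add: a_minus_def h.hom_nat_pow eval_var)
  qed
  define F where "F = {a \<in> carrier R. a [^] q = a}"
  have rootF: "is_root f a \<longleftrightarrow> a \<in> F" for a
    unfolding is_root_def F_def using f0 evf r_right_minus_eq by auto
  have charU: "add_pow ?U p \<one>\<^bsub>?U\<^esub> = \<zero>\<^bsub>?U\<^esub>"
  proof -
    interpret h: ring_hom_ring R ?U poly_of_const
      using canonical_embedding_ring_hom[OF carrier_is_subring] by simp
    have "poly_of_const ([p] \<cdot> \<one>) = add_pow ?U p \<one>\<^bsub>?U\<^esub>"
      by (induction p) auto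
    then show ?thesis using p by simp
  qed
  have simple: "alg_mult f a \<le> 1" if aF: "a \<in> F" for a
  proof (rule ccontr)
    assume "\<not> alg_mult f a \<le> 1"
    then have "2 \<le> alg_mult f a" by simp
    have a: "a \<in> carrier R" "a [^] q = a" using aF by (auto simp: F_def)
    define d where "d = [\<one>, \<ominus> a]"
    define c where "c = poly_of_const a"
    have cc: "c \<in> carrier ?U" and cq: "c [^]\<^bsub>?U\<^esub> q = c"
    proof -
      interpret h: ring_hom_ring R ?U poly_of_const
        using canonical_embedding_ring_hom[OF carrier_is_subring] by simp
      show "c \<in> carrier ?U" unfolding c_def using a by simp
      show "c [^]\<^bsub>?U\<^esub> q = c" unfolding c_def using a h.hom_nat_pow[of a q] by simp
    qed
    have dc: "d \<in> carrier ?U"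
      using a by (auto simp: d_def univ_poly_carrier[symmetric] polynomial_def)
    have Xd: "X = d \<oplus>\<^bsub>?U\<^esub> c"
      using a by (auto simp: d_def c_def poly_of_const_def var_def univ_poly_add l_neg)
    have "X [^]\<^bsub>?U\<^esub> q = d [^]\<^bsub>?U\<^esub> q \<oplus>\<^bsub>?U\<^esub> c"
      unfolding Xd using U.frobenius_add[OF p(1) charU dc cc, of n] cq by (simp add: q_def)
    then have "f = (d [^]\<^bsub>?U\<^esub> q \<oplus>\<^bsub>?U\<^esub> c) \<ominus>\<^bsub>?U\<^esub> (d \<oplus>\<^bsub>?U\<^esub> c)"
      unfolding fU Xd by simp
    also have "\<dots> = d [^]\<^bsub>?U\<^esub> q \<ominus>\<^bsub>?U\<^esub> d"
    proof -
      have "d [^]\<^bsub>?U\<^esub> q \<in> carrier ?U" using dc by simp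
      with dc cc show ?thesis by algebra
    qed
    also have "d [^]\<^bsub>?U\<^esub> q = d \<otimes>\<^bsub>?U\<^esub> d [^]\<^bsub>?U\<^esub> (q - 1)"
      using q dc U.nat_pow_Suc2[OF dc, of "q - 1"] by simp
    also have "d \<otimes>\<^bsub>?U\<^esub> d [^]\<^bsub>?U\<^esub> (q - 1) \<ominus>\<^bsub>?U\<^esub> d = d \<otimes>\<^bsub>?U\<^esub> (d [^]\<^bsub>?U\<^esub> (q - 1) \<ominus>\<^bsub>?U\<^esub> \<one>\<^bsub>?U\<^esub>)"
    proof -
      have "d [^]\<^bsub>?U\<^esub> (q - 1) \<in> carrier ?U" using dc by simp
      with dc show ?thesis by algebra
    qed
    finally have f1: "f = d \<otimes>\<^bsub>?U\<^esub> (d [^]\<^bsub>?U\<^esub> (q - 1) \<ominus>\<^bsub>?U\<^esub> \<one>\<^bsub>?U\<^esub>)" .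
    have "(d [^]\<^bsub>?U\<^esub> (2::nat)) pdivides f"
      unfolding d_def by (rule le_alg_mult_imp_pdivides) (use a fc \<open>2 \<le> _\<close> in auto)
    then obtain s where s: "s \<in> carrier ?U" "f = d [^]\<^bsub>?U\<^esub> (2::nat) \<otimes>\<^bsub>?U\<^esub> s"
      unfolding pdivides_def factor_def by auto
    have "d \<noteq> \<zero>\<^bsub>?U\<^esub>" by (simp add: d_def univ_poly_zero)
    have "d [^]\<^bsub>?U\<^esub> (2::nat) \<otimes>\<^bsub>?U\<^esub> s = d \<otimes>\<^bsub>?U\<^esub> (d \<otimes>\<^bsub>?U\<^esub> s)"
      using dc s by (simp add: numeral_2_eq_2 U.m_assoc)
    then have "d \<otimes>\<^bsub>?U\<^esub> (d \<otimes>\<^bsub>?U\<^esub> s) = d \<otimes>\<^bsub>?U\<^esub> (d [^]\<^bsub>?U\<^esub> (q - 1) \<ominus>\<^bsub>?U\<^esub> \<one>\<^bsub>?U\<^esub>)"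
      using f1 s by simp
    then have e: "d \<otimes>\<^bsub>?U\<^esub> s = d [^]\<^bsub>?U\<^esub> (q - 1) \<ominus>\<^bsub>?U\<^esub> \<one>\<^bsub>?U\<^esub>"
      using \<open>d \<noteq> \<zero>\<^bsub>?U\<^esub>\<close> dc s U.m_lcancel by (meson U.m_closed U.minus_closed U.nat_pow_closed U.one_closed)
    interpret h: ring_hom_ring ?U R "\<lambda>g. eval g a"
      using hom[OF a(1)] U.ring_axioms ring_axioms by (intro ring_hom_ringI2)
    have ed: "eval d a = \<zero>" using a by (simp add: d_def r_neg)
    have "eval (d \<otimes>\<^bsub>?U\<^esub> s) a = \<zero>" using ed dc s by simp
    moreover have "eval (d [^]\<^bsub>?U\<^esub> (q - 1) \<ominus>\<^bsub>?U\<^esub> \<one>\<^bsub>?U\<^esub>) a = \<ominus> \<one>"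
      using ed dc q by (simp add: a_minus_def h.hom_nat_pow nat_pow_zero)
    ultimately have "\<ominus> \<one> = \<zero>" using e by simp
    then have "\<ominus> (\<ominus> \<one>) = \<zero>" by simp
    then have "\<one> = \<zero>" using minus_minus[OF one_closed] by simp
    then show False by simp
  qed
  have "roots f = mset_set F" and finF: "finite F"
  proof -
    have set: "set_mset (roots f) = F"
      using roots_mem_iff_is_root[OF fc] rootF by auto
    then show "finite F" by (metis finite_set_mset)
    show "roots f = mset_set F"
    proof (rule multiset_eqI)
      fix a show "count (roots f) a = count (mset_set F) a"
      proof (cases "a \<in> F")
        case True
        then have "count (roots f) a > 0" using set by simp
        then have "count (roots f) a = 1"
          using simple[OF True] unfolding alg_mult_eq_count_roots[OF fc] by linarith
        then show ?thesis using True \<open>finite F\<close> by simp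
      next
        case False
        then show ?thesis using set \<open>finite F\<close> by (simp add: count_eq_zero_iff)
      qed
    qed
  qed
  then have card: "card F = q"
    using spl deg unfolding splitted_def by (simp only: size_mset_set)
  have one: "\<one> \<in> F" by (simp add: F_def)
  have add: "x \<oplus> y \<in> F" if "x \<in> F" "y \<in> F" for x y
    using that frobenius_add[OF p, of x y n] by (simp add: F_def q_def)
  have mult: "x \<otimes> y \<in> F" if "x \<in> F" "y \<in> F" for x y
    using that by (simp add: F_def nat_pow_distrib)
  have neg: "\<ominus> x \<in> F" if x: "x \<in> F" for x
  proof -
    have xc: "x \<in> carrier R" "x [^] q = x" using x by (auto simp: F_def)
    have "(x \<oplus> \<ominus> x) [^] q = x [^] q \<oplus> (\<ominus> x) [^] q"
      unfolding q_def by (rule frobenius_add) (use p xc in auto)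
    then have "x \<oplus> (\<ominus> x) [^] q = \<zero>" using xc q by (simp add: r_neg nat_pow_zero)
    then have "(\<ominus> x) [^] q = \<ominus> x"
      using xc by (intro sum_zero_eq_neg) (auto simp: a_comm)
    then show ?thesis using xc by (simp add: F_def)
  qed
  have sub: "subring F R"
  proof (rule subringI)
    show "F \<subseteq> carrier R" by (auto simp: F_def)
  qed (fact one neg mult add)+
  have "subfield F R"
  proof (rule subfieldI'[OF sub])
    fix k assume k: "k \<in> F - {\<zero>}"
    then have kc: "k \<in> carrier R" "k [^] q = k" and kU: "k \<in> Units R"
      by (auto simp: F_def field_Units)
    have ic: "inv k \<in> carrier R" by (rule Units_inv_closed[OF kU])
    have "k [^] q \<otimes> (inv k) [^] q = \<one>"
      using nat_pow_distrib[OF kc(1) ic, of q] by (simp only: Units_r_inv[OF kU] nat_pow_one)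
    then have "k \<otimes> (inv k) [^] q = \<one>" by (simp only: kc(2))
    then have "inv k = (inv k) [^] q"
      by (rule comm_inv_char[OF kc(1) nat_pow_closed[OF ic]])
    then show "inv k \<in> F" unfolding F_def using ic by (metis (mono_tags) mem_Collect_eq)
  qed
  then show ?thesis using card unfolding q_def by (intro exI conjI)
qed

lemma ex_field_of_order:
  assumes "Factorial_Ring.prime p" and "n > 0"
  shows "\<exists>F :: nat ring. field F \<and> order F = p ^ n"
proof -
  let ?Z = "residue_ring (int p)"
  interpret Z: residues_prime p ?Z by unfold_locales (use assms in auto)
  obtain L :: "((int list \<times> nat) multiset \<Rightarrow> int) ring"
    where L: "algebraic_closure L (Z.indexed_const ` carrier ?Z)"
      and hom: "Z.indexed_const \<in> ring_hom ?Z L"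
    by (rule Z.exists_closure)
  interpret L: algebraic_closure L "Z.indexed_const ` carrier ?Z" by (rule L)
  interpret h: ring_hom_ring ?Z L Z.indexed_const
    using hom by (intro ring_hom_ringI2 Z.ring_axioms L.ring_axioms)
  have pow: "add_pow ?Z k \<one>\<^bsub>?Z\<^esub> = int k mod int p" for k :: nat
  proof (induction k)
    case 0 then show ?case by (simp add: Z.res_zero_eq)
  next
    case (Suc k)
    have "add_pow ?Z (Suc k) \<one>\<^bsub>?Z\<^esub> = add_pow ?Z k \<one>\<^bsub>?Z\<^esub> \<oplus>\<^bsub>?Z\<^esub> \<one>\<^bsub>?Z\<^esub>"
      by (rule Z.add.nat_pow_Suc)
    also have "\<dots> = (int k mod int p + 1) mod int p"
      unfolding Suc by (simp only: Z.res_add_eq Z.res_one_eq)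
    also have "\<dots> = int (Suc k) mod int p"
      unfolding mod_add_left_eq of_nat_Suc add.commute[of 1] ..
    finally show ?case .
  qed
  have pow': "Z.indexed_const (add_pow ?Z k \<one>\<^bsub>?Z\<^esub>) = add_pow L k \<one>\<^bsub>L\<^esub>" for k :: nat
  proof (induction k)
    case 0
    show ?case by (simp only: Z.add.nat_pow_0 L.add.nat_pow_0 h.hom_zero)
  next
    case (Suc k)
    have "Z.indexed_const (add_pow ?Z (Suc k) \<one>\<^bsub>?Z\<^esub>) =
        Z.indexed_const (add_pow ?Z k \<one>\<^bsub>?Z\<^esub>) \<oplus>\<^bsub>L\<^esub> Z.indexed_const \<one>\<^bsub>?Z\<^esub>"
      unfolding Z.add.nat_pow_Suc by (rule h.hom_add[OF Z.add.nat_pow_closed[OF Z.one_closed] Z.one_closed])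
    then show ?case unfolding L.add.nat_pow_Suc Suc h.hom_one .
  qed
  have "add_pow ?Z p \<one>\<^bsub>?Z\<^esub> = \<zero>\<^bsub>?Z\<^esub>" by (simp only: pow Z.res_zero_eq mod_self)
  then have char: "add_pow L p \<one>\<^bsub>L\<^esub> = \<zero>\<^bsub>L\<^esub>"
    unfolding pow'[symmetric] by (simp only: h.hom_zero)
  have "\<exists>F. subfield F L \<and> card F = p ^ n"
    by (rule L.ex_subfield_of_order[OF assms(1) char assms(2) L.subring_axioms])
      (rule L.roots_over_subfield)
  then obtain F where F: "subfield F L" "card F = p ^ n" by (elim exE conjE)
  have "card F > 0" unfolding F(2) using prime_gt_0_nat[OF assms(1)] by (rule zero_less_power)
  then have "finite F" by (rule card_ge_0_finite)
  then obtain g :: "_ \<Rightarrow> nat" and m where "g ` F = {i. i < m}" and g: "inj_on g F"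
    by (elim finite_imp_inj_to_nat_seg[THEN exE] exE conjE)
  interpret F: field "L\<lparr>carrier := F\<rparr>" using L.subfield_iff(2)[OF F(1)] .
  have "field (image_ring g (L\<lparr>carrier := F\<rparr>))"
    using g by (intro F.inj_imp_image_ring_is_field) simp
  moreover have "order (image_ring g (L\<lparr>carrier := F\<rparr>)) = p ^ n"
    using card_image[OF g] F(2) by (simp add: order_def image_ring_carrier)
  ultimately show ?thesis by (intro exI conjI)
qed

lemma GF_prime_power:
  assumes "Factorial_Ring.prime p" and "n > 0"
  shows "field (GF (p ^ n))" and "finite (carrier (GF (p ^ n)))" and "order (GF (p ^ n)) = p ^ n"
proof -
  have *: "field (GF (p ^ n)) \<and> order (GF (p ^ n)) = p ^ n"
    unfolding GF_def by (rule someI_ex) (rule ex_field_of_order[OF assms])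
  then show "field (GF (p ^ n))" "order (GF (p ^ n)) = p ^ n" by auto
  show "finite (carrier (GF (p ^ n)))"
    using * prime_gt_0_nat[OF assms(1)] by (auto simp: order_def intro: card_ge_0_finite)
qed

end

theory Submission
  imports
    "HOL-Library.Function_Algebras"
    "HOL-Computational_Algebra.Polynomial"
    Defs
begin

text \<open>
  Write \<open>P\<close> as a direct product of cyclic groups of orders \<open>p ^ a 0, \<dots>, p ^ a (m - 1)\<close>. For \<open>n \<ge> 1\<close>
  let \<open>W n\<close> be the Galois ring \<open>\<int>[X] / (p ^ n, f)\<close>, where \<open>f\<close> is monic of degree \<open>l\<close> and irreducible
  modulo \<open>p\<close>; its residue field is \<open>GF (p ^ l)\<close>. The ring \<open>A\<close> is the fibre product of the rings
  \<open>W (a i + 1)\<close> over their common residue field: the tuples whose components all have the same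
  residue. Since \<open>p\<close> is odd, the group \<open>1 + p W n\<close> is a direct product of \<open>l\<close> cyclic groups of order
  \<open>p ^ (n - 1)\<close>, so the units of \<open>A\<close> with residue \<open>1\<close> form a group isomorphic to \<open>P ^ l\<close>. The units of
  the residue field lift to \<open>A\<close> as Teichmueller representatives.

  The isomorphism is not written down. Instead both groups are images of the same monoid
  of exponents \<open>(c, e)\<close>: on one side by
  \<open>(c, e) \<mapsto> (x ^ c, (\<Prod>i. g i ^ e i j) for j < l)\<close>, with \<open>x\<close> a generator of the multiplicative group of
  the residue field and \<open>g\<close> a basis of \<open>P\<close>; on the other by sending \<open>(c, e)\<close> to the class of the tuple
  with \<open>i\<close>-th component \<open>X ^ (p ^ N * c) * (\<Prod>j<l. (1 + p * X ^ j) ^ e i j)\<close>, for a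
  suitable large \<open>N\<close>. Both maps are surjective homomorphisms and identify the same pairs of exponents, so their images are isomorphic
  (\<open>iso_of_common_cover\<close>).

  The work is carried by \<open>unit_prod_cong_iff\<close> and \<open>unit_prod_surj\<close>, which describe \<open>1 + p W n\<close>, by
  \<open>finite_p_group_basis\<close>, which decomposes \<open>P\<close>, by \<open>int_poly_presentation\<close>, which produces \<open>f\<close> from
  the finite field, and by \<open>ex_local_ring\<close>, which assembles \<open>A\<close>.
\<close>

section \<open>Congruences modulo a power of \<open>p\<close> and a polynomial\<close>

text \<open>Congruence modulo the ideal generated by \<open>p ^ n\<close> and \<open>f\<close>.\<close>

definition cong_mod :: "'r::comm_ring_1 \<Rightarrow> nat \<Rightarrow> nat \<Rightarrow> 'r \<Rightarrow> 'r \<Rightarrow> bool" where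
  "cong_mod f p n a b \<longleftrightarrow> (\<exists>u v. a - b = of_nat p ^ n * u + f * v)"

lemma cong_modI: "a = b + of_nat p ^ n * u + f * v \<Longrightarrow> cong_mod f p n a b"
  unfolding cong_mod_def by (intro exI[of _ u] exI[of _ v]) simp

lemma cong_modE:
  assumes "cong_mod f p n a b"
  obtains u v where "a = b + of_nat p ^ n * u + f * v"
  using assms unfolding cong_mod_def by (metis add.assoc add.commute diff_add_cancel)

lemma cong_mod_refl [simp]: "cong_mod f p n a a"
  by (rule cong_modI[of _ _ _ _ 0 _ 0]) simp

lemma cong_mod_sym: "cong_mod f p n a b \<Longrightarrow> cong_mod f p n b a"
proof (elim cong_modE)
  fix u v assume "a = b + of_nat p ^ n * u + f * v"
  then show "cong_mod f p n b a"
    by (intro cong_modI[of _ _ _ _ "- u" _ "- v"]) (simp add: algebra_simps)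
qed

lemma cong_mod_add:
  "cong_mod f p n a b \<Longrightarrow> cong_mod f p n c d \<Longrightarrow> cong_mod f p n (a + c) (b + d)"
proof (elim cong_modE)
  fix u v u' v' assume "a = b + of_nat p ^ n * u + f * v" "c = d + of_nat p ^ n * u' + f * v'"
  then show "cong_mod f p n (a + c) (b + d)"
    by (intro cong_modI[of _ _ _ _ "u + u'" _ "v + v'"]) (simp add: algebra_simps)
qed

lemma cong_mod_trans: "cong_mod f p n a b \<Longrightarrow> cong_mod f p n b c \<Longrightarrow> cong_mod f p n a c"
  using cong_mod_add[of f p n a b b c] by (simp add: cong_mod_def)

lemma cong_mod_mult_left: "cong_mod f p n a b \<Longrightarrow> cong_mod f p n (c * a) (c * b)"
proof (elim cong_modE)
  fix u v assume "a = b + of_nat p ^ n * u + f * v"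
  then show "cong_mod f p n (c * a) (c * b)"
    by (intro cong_modI[of _ _ _ _ "c * u" _ "c * v"]) (simp add: algebra_simps)
qed

lemma cong_mod_mult:
  "cong_mod f p n a b \<Longrightarrow> cong_mod f p n c d \<Longrightarrow> cong_mod f p n (a * c) (b * d)"
  by (metis cong_mod_mult_left cong_mod_trans mult.commute)

lemma cong_mod_power: "cong_mod f p n a b \<Longrightarrow> cong_mod f p n (a ^ k) (b ^ k)"
  by (induction k) (auto intro: cong_mod_mult)

lemma cong_mod_sum:
  "(\<And>i. i \<in> I \<Longrightarrow> cong_mod f p n (a i) (b i)) \<Longrightarrow> cong_mod f p n (sum a I) (sum b I)"
  by (induction I rule: infinite_finite_induct) (auto intro: cong_mod_add)

lemma cong_mod_mono: "cong_mod f p n a b \<Longrightarrow> m \<le> n \<Longrightarrow> cong_mod f p m a b"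
proof (elim cong_modE)
  fix u v assume "m \<le> n" and *: "a = b + of_nat p ^ n * u + f * v"
  from \<open>m \<le> n\<close> have "(of_nat p :: 'a) ^ n = of_nat p ^ m * of_nat p ^ (n - m)"
    by (simp add: power_add[symmetric])
  with * show "cong_mod f p m a b"
    by (intro cong_modI[of _ _ _ _ "of_nat p ^ (n - m) * u" _ v]) (simp add: algebra_simps)
qed

lemma cong_mod_shift: "cong_mod f p n a b \<Longrightarrow> cong_mod f p (k + n) (of_nat p ^ k * a) (of_nat p ^ k * b)"
proof (elim cong_modE)
  fix u v assume *: "a = b + of_nat p ^ n * u + f * v"
  then show "cong_mod f p (k + n) (of_nat p ^ k * a) (of_nat p ^ k * b)"
    by (intro cong_modI[of _ _ _ _ u _ "of_nat p ^ k * v"]) (simp add: algebra_simps power_add)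
qed

lemma power_one_plus_expand:
  fixes z :: "'r::comm_ring_1"
  shows "\<exists>w. (1 + z) ^ n = 1 + of_nat n * z + of_nat (n choose 2) * z ^ 2 + z ^ 3 * w"
proof (induction n)
  case 0
  show ?case by (rule exI[of _ 0]) (simp add: numeral_2_eq_2)
next
  case (Suc n)
  then obtain w where w: "(1 + z) ^ n = 1 + of_nat n * z + of_nat (n choose 2) * z ^ 2 + z ^ 3 * w" ..
  have "Suc n choose 2 = n + (n choose 2)"
    by (simp add: numeral_2_eq_2)
  then have "(1 + z) ^ Suc n = 1 + of_nat (Suc n) * z + of_nat (Suc n choose 2) * z ^ 2
      + z ^ 3 * (of_nat (n choose 2) + w + w * z)"
    by (simp add: w algebra_simps power2_eq_square power3_eq_cube)
  then show ?case ..
qed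

lemma power_one_plus_p_multiple:
  fixes y :: "'r::comm_ring_1"
  assumes "odd p"
  shows "\<exists>v. (1 + of_nat p ^ Suc k * y) ^ p = 1 + of_nat p ^ Suc (Suc k) * (y + of_nat p * v)"
proof -
  define P where "P = (of_nat p :: 'r)"
  obtain w where w: "(1 + P ^ Suc k * y) ^ p = 1 + of_nat p * (P ^ Suc k * y)
      + of_nat (p choose 2) * (P ^ Suc k * y) ^ 2 + (P ^ Suc k * y) ^ 3 * w"
    using power_one_plus_expand by blast
  \<comment> \<open>Oddness of \<open>p\<close> makes the second binomial coefficient a multiple of \<open>p\<close>.\<close>
  obtain m where "p choose 2 = p * m"
  proof -
    obtain b where "p = Suc (2 * b)" using assms by (auto elim: oddE)
    then have "p choose 2 = p * b" by (simp add: choose_two)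
    then show thesis by (rule that)
  qed
  then have m: "(of_nat (p choose 2) :: 'r) = P * of_nat m" by (simp add: P_def)
  have e2: "P * (P ^ Suc k * y) ^ 2 = P ^ Suc (Suc k) * (P * (P ^ k * y ^ 2))"
    by (simp add: power_mult_distrib power2_eq_square algebra_simps)
  have e3: "(P ^ Suc k * y) ^ 3 = P ^ Suc (Suc k) * (P * (P ^ k * P ^ k * y ^ 3))"
    by (simp add: power_mult_distrib power3_eq_cube algebra_simps)
  have "(1 + P ^ Suc k * y) ^ p = 1 + P ^ Suc (Suc k) *
      (y + P * (of_nat m * (P ^ k * y ^ 2) + P ^ k * P ^ k * y ^ 3 * w))"
    unfolding w m e3 using arg_cong[OF e2, of "\<lambda>t. of_nat m * t"]
    by (simp add: P_def[symmetric] algebra_simps)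
  then show ?thesis unfolding P_def by blast
qed

text \<open>This is sharper than \<open>cong_mod_power_prime_power\<close>: for odd \<open>p\<close>, raising to the power \<open>p ^ k\<close>
  multiplies the deviation from \<open>1\<close> by \<open>p ^ k\<close>, up to higher order terms. It fails for \<open>p = 2\<close>.\<close>

lemma power_one_plus_p_prime_power:
  fixes y :: "'r::comm_ring_1"
  assumes "odd p"
  shows "\<exists>v. (1 + of_nat p * y) ^ (p ^ k) = 1 + of_nat p ^ Suc k * (y + of_nat p * v)"
proof (induction k)
  case 0
  show ?case by (rule exI[of _ 0]) simp
next
  case (Suc k)
  then obtain v where v: "(1 + of_nat p * y) ^ (p ^ k) = 1 + of_nat p ^ Suc k * (y + of_nat p * v)" ..
  obtain w where "(1 + of_nat p ^ Suc k * (y + of_nat p * v)) ^ p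
      = 1 + of_nat p ^ Suc (Suc k) * (y + of_nat p * v + of_nat p * w)"
    using power_one_plus_p_multiple[OF assms] by blast
  then have "(1 + of_nat p * y) ^ (p ^ Suc k) = 1 + of_nat p ^ Suc (Suc k) * (y + of_nat p * (v + w))"
    by (simp only: v power_Suc2 power_mult distrib_left add.assoc)
  then show ?case ..
qed

text \<open>Each \<open>p\<close>-th power gains one power of \<open>p\<close>: \<open>a ^ p - b ^ p\<close> is \<open>a - b\<close> times a sum of \<open>p\<close> terms that are
  all congruent to \<open>b ^ (p - 1)\<close> modulo \<open>(p, f)\<close>.\<close>

lemma cong_mod_power_prime:
  assumes "cong_mod f p (Suc k) a b"
  shows "cong_mod f p (Suc (Suc k)) (a ^ p) (b ^ p)"
proof -
  obtain u v where uv: "a = b + of_nat p ^ Suc k * u + f * v"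
    using assms by (rule cong_modE)
  define s where "s = (\<Sum>i<p. b ^ (p - Suc i) * a ^ i)"
  have ab: "cong_mod f p 1 a b" using assms by (rule cong_mod_mono) simp
  have "cong_mod f p 1 s (\<Sum>i<p. b ^ (p - Suc i) * b ^ i)"
    unfolding s_def
    by (intro cong_mod_sum cong_mod_mult_left cong_mod_power ab)
  also have "(\<Sum>i<p. b ^ (p - Suc i) * b ^ i) = of_nat p * b ^ (p - 1)"
    by (simp add: power_add[symmetric])
  finally obtain u' v' where s: "s = of_nat p * b ^ (p - 1) + of_nat p * u' + f * v'"
    by (auto elim: cong_modE)
  have "a ^ p = b ^ p + (a - b) * s"
    unfolding s_def using power_diff_sumr2[of a p b] by (simp add: algebra_simps)
  also have "(a - b) * s = of_nat p ^ Suc k * u * s + f * (v * s)"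
    unfolding uv by (simp add: algebra_simps)
  also have "of_nat p ^ Suc k * u * s = of_nat p ^ Suc (Suc k) * (u * (b ^ (p - 1) + u'))
      + f * (of_nat p ^ Suc k * u * v')"
    unfolding s by (simp add: algebra_simps)
  finally show ?thesis
    by (intro cong_modI[of _ _ _ _ "u * (b ^ (p - 1) + u')" _ "of_nat p ^ Suc k * u * v' + v * s"])
      (simp add: algebra_simps)
qed

lemma cong_mod_power_prime_power:
  assumes "cong_mod f p 1 a b"
  shows "cong_mod f p (Suc k) (a ^ (p ^ k)) (b ^ (p ^ k))"
proof (induction k)
  case 0
  then show ?case using assms by simp
next
  case (Suc k)
  then show ?case
    using cong_mod_power_prime[OF Suc] by (simp add: power_mult[symmetric] mult.commute)
qed

lemma prod_one_plus_p_expand: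
  fixes x :: "nat \<Rightarrow> 'r::comm_ring_1"
  shows "\<exists>v. (\<Prod>j<l. (1 + of_nat p * x j) ^ c j)
    = 1 + of_nat p * ((\<Sum>j<l. of_nat (c j) * x j) + of_nat p * v)"
proof (induction l)
  case 0
  show ?case by (rule exI[of _ 0]) simp
next
  case (Suc l)
  then obtain v where v: "(\<Prod>j<l. (1 + of_nat p * x j) ^ c j)
    = 1 + of_nat p * ((\<Sum>j<l. of_nat (c j) * x j) + of_nat p * v)" ..
  obtain w where w: "(1 + of_nat p * x l) ^ c l = 1 + of_nat (c l) * (of_nat p * x l)
      + of_nat (c l choose 2) * (of_nat p * x l) ^ 2 + (of_nat p * x l) ^ 3 * w"
    using power_one_plus_expand by blast
  define s where "s = (\<Sum>j<l. of_nat (c j) * x j)"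
  define P where "P = (of_nat p :: 'r)"
  note v = v[folded s_def P_def]
  define w' where "w' = of_nat (c l choose 2) * x l ^ 2 + P * x l ^ 3 * w"
  have w': "(1 + P * x l) ^ c l = 1 + P * (of_nat (c l) * x l + P * w')"
    unfolding P_def w w'_def by (simp add: algebra_simps power2_eq_square power3_eq_cube)
  have "(1 + P * (s + P * v)) * (1 + P * (of_nat (c l) * x l + P * w'))
     = 1 + P * (s + of_nat (c l) * x l + P * (v + w' + (s + P * v) * (of_nat (c l) * x l + P * w')))"
    by (simp add: algebra_simps)
  then show ?case
    unfolding prod.lessThan_Suc sum.lessThan_Suc s_def[symmetric] P_def[symmetric] v w'
    by (intro exI) assumption
qed

section \<open>The principal units of a Galois ring\<close>

lemma int_poly_monic_division:
  fixes f a :: "int poly"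
  assumes "Polynomial.lead_coeff f = 1" and "Polynomial.degree f > 0"
  obtains q r where "a = f * q + r" and "Polynomial.degree r < Polynomial.degree f"
proof -
  have f0: "f \<noteq> 0" using assms(1) by auto
  obtain q r where "pseudo_divmod a f = (q, r)" by (cases "pseudo_divmod a f")
  from pseudo_divmod[OF f0 this] have "a = f * q + r" "r = 0 \<or> Polynomial.degree r < Polynomial.degree f"
    using assms(1) by auto
  then show thesis using assms(2) that[of q r] by auto
qed

text \<open>A monic modulus \<open>f\<close> makes \<open>\<int>[X] / (f)\<close> a free module with basis \<open>1, X, \<dots>, X ^ (l - 1)\<close>. Neither
  irreducibility of \<open>f\<close> modulo \<open>p\<close> nor primality of \<open>p\<close> plays a role in this section.\<close>

locale monic_modulus =
  fixes f :: "int poly" and p l :: nat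
  assumes monic: "Polynomial.lead_coeff f = 1" and degree_f: "Polynomial.degree f = l" and l_pos: "l > 0"
    and p_odd: "odd p" and p_gt_1: "p > 1"
begin

abbreviation cong_pf :: "nat \<Rightarrow> int poly \<Rightarrow> int poly \<Rightarrow> bool" where
  "cong_pf \<equiv> cong_mod f p"

abbreviation x_pow :: "nat \<Rightarrow> int poly" where "x_pow j \<equiv> Polynomial.monom 1 j"

lemma monic_division:
  obtains q r where "a = f * q + r" and "Polynomial.degree r < l"
  using int_poly_monic_division[OF monic] degree_f l_pos by metis

lemma multiple_of_small_degree:
  assumes "a = f * c" and "Polynomial.degree a < l"
  shows "a = 0"
proof (rule ccontr)
  assume "a \<noteq> 0"
  then have "Polynomial.degree a = Polynomial.degree f + Polynomial.degree c"
    using assms(1) by (auto intro: degree_mult_eq)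
  then show False using assms(2) degree_f by simp
qed

lemma of_nat_mult_coeff: "poly.coeff (of_nat m * b :: int poly) j = int m * poly.coeff b j"
  by (simp add: of_nat_poly)

text \<open>The powers of \<open>p\<close> are cancelled in \<open>\<int>[X] / (f)\<close> by comparing remainders modulo \<open>f\<close>.\<close>

lemma cong_pf_cancel:
  assumes "cong_pf n (of_nat p ^ k * u) 0" and "k < n"
  shows "cong_pf 1 u 0"
proof -
  obtain b c where bc: "of_nat p ^ k * u = of_nat p ^ n * b + f * c"
    using assms(1) by (auto elim: cong_modE)
  obtain q r where u: "u = f * q + r" and r: "Polynomial.degree r < l" by (rule monic_division)
  obtain q' r' where b: "b = f * q' + r'" and r': "Polynomial.degree r' < l" by (rule monic_division)
  let ?d = "of_nat (p ^ k) * r - of_nat (p ^ n) * r'"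
  have "?d = f * (c + of_nat p ^ n * q' - of_nat p ^ k * q)"
    using bc unfolding u b by (simp add: algebra_simps)
  moreover have "Polynomial.degree ?d < l"
    using r r' by (intro degree_diff_less) (simp_all add: of_nat_poly)
  ultimately have "?d = 0" by (rule multiple_of_small_degree)
  moreover have "n = k + Suc (n - Suc k)" using \<open>k < n\<close> by simp
  then have "p ^ n = p ^ k * (p * p ^ (n - Suc k))" by (metis power_Suc power_add)
  ultimately have "of_nat (p ^ k) * (r - of_nat p * (of_nat (p ^ (n - Suc k)) * r')) = 0"
    by (simp add: algebra_simps)
  moreover have "(of_nat (p ^ k) :: int poly) \<noteq> 0" using p_gt_1 by simp
  ultimately have "r - of_nat p * (of_nat (p ^ (n - Suc k)) * r') = 0"
    by (metis mult_eq_0_iff)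
  then have "r = of_nat p * (of_nat (p ^ (n - Suc k)) * r')" by simp
  then show ?thesis
    by (intro cong_modI[of _ _ _ _ "of_nat (p ^ (n - Suc k)) * r'" _ q]) (simp add: u)
qed

lemma degree_sum_x_pow: "Polynomial.degree (\<Sum>j<l. of_nat (d j) * x_pow j) < l"
  using l_pos by (intro degree_sum_less) (auto simp: of_nat_poly Polynomial.smult_monom intro: le_less_trans[OF degree_monom_le])

lemma coeff_sum_x_pow: "j < l \<Longrightarrow> poly.coeff (\<Sum>j<l. of_nat (d j) * x_pow j) j = int (d j)"
  by (simp add: coeff_sum of_nat_mult_coeff if_distrib[of "\<lambda>t. int _ * t"] cong: if_cong)

lemma basis_mod_p_independent:
  assumes "cong_pf 1 (\<Sum>j<l. of_nat (d j) * x_pow j) 0" and "j < l"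
  shows "p dvd d j"
proof -
  define a where "a = (\<Sum>j<l. of_nat (d j) * x_pow j)"
  obtain b c where bc: "a = of_nat p * b + f * c"
    using assms(1) unfolding a_def by (auto elim: cong_modE)
  obtain q r where b: "b = f * q + r" and r: "Polynomial.degree r < l" by (rule monic_division)
  have "a - of_nat p * r = f * (c + of_nat p * q)"
    unfolding bc b by (simp add: algebra_simps)
  moreover have "Polynomial.degree (a - of_nat p * r) < l"
    using r degree_sum_x_pow by (intro degree_diff_less) (simp_all add: of_nat_poly a_def)
  ultimately have "a - of_nat p * r = 0" by (rule multiple_of_small_degree)
  then have "poly.coeff a j = int p * poly.coeff r j" by (simp add: of_nat_mult_coeff)
  then have "int (d j) = int p * poly.coeff r j" unfolding a_def coeff_sum_x_pow[OF \<open>j < l\<close>] .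
  then have "int p dvd int (d j)" by simp
  then show ?thesis by simp
qed

lemma basis_mod_p_spans: "\<exists>d. cong_pf 1 u (\<Sum>j<l. of_nat (d j) * x_pow j)"
proof -
  obtain q r where u: "u = f * q + r" and r: "Polynomial.degree r < l" by (rule monic_division)
  define d where "d j = nat (poly.coeff r j mod int p)" for j
  define b where "b = (\<Sum>j<l. Polynomial.monom (poly.coeff r j div int p) j)"
  have "r = (\<Sum>j<l. of_nat (d j) * x_pow j) + of_nat p * b"
  proof (rule poly_eqI)
    fix j
    have "poly.coeff b j = (if j < l then poly.coeff r j div int p else 0)"
      by (simp add: b_def coeff_sum)
    moreover have "poly.coeff (\<Sum>j<l. of_nat (d j) * x_pow j) j = (if j < l then poly.coeff r j mod int p else 0)"
    proof (cases "j < l")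
      case True
      then show ?thesis using p_gt_1 unfolding coeff_sum_x_pow[OF True] by (simp add: d_def)
    next
      case False
      then show ?thesis using degree_sum_x_pow[of d] by (simp add: coeff_eq_0)
    qed
    ultimately show "poly.coeff r j = poly.coeff ((\<Sum>j<l. of_nat (d j) * x_pow j) + of_nat p * b) j"
      using r by (auto simp: of_nat_mult_coeff coeff_eq_0)
  qed
  then have "u = (\<Sum>j<l. of_nat (d j) * x_pow j) + of_nat p ^ 1 * b + f * q"
    by (simp add: u)
  then show ?thesis by (blast intro: cong_modI)
qed

text \<open>The general product of powers of the elements \<open>1 + p * X ^ j\<close> with \<open>j < l\<close>, which turn out to
  form a basis of the group of classes congruent to \<open>1\<close> modulo \<open>p\<close> in each ring
  \<open>\<int>[X] / (p ^ (a + 1), f)\<close>. Exponents are natural numbers; this loses nothing because these groups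
  are finite.\<close>

definition unit_prod :: "(nat \<Rightarrow> nat) \<Rightarrow> int poly" where
  "unit_prod c = (\<Prod>j<l. (1 + of_nat p * x_pow j) ^ c j)"

lemma unit_prod_add: "unit_prod (\<lambda>j. c j + d j) = unit_prod c * unit_prod d"
  by (simp add: unit_prod_def power_add prod.distrib)

lemma unit_prod_mult: "unit_prod (\<lambda>j. k * c j) = unit_prod c ^ k"
  by (simp add: unit_prod_def mult.commute[of k] power_mult prod_power_distrib)

lemma unit_prod_cong_1: "cong_pf 1 (unit_prod c) 1"
proof -
  obtain v where "unit_prod c = 1 + of_nat p * ((\<Sum>j<l. of_nat (c j) * x_pow j) + of_nat p * v)"
    using prod_one_plus_p_expand unfolding unit_prod_def by blast
  then show ?thesis
    by (intro cong_modI[of _ _ _ _ "(\<Sum>j<l. of_nat (c j) * x_pow j) + of_nat p * v" _ 0]) simp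
qed

lemma unit_prod_prime_power:
  "\<exists>v. unit_prod (\<lambda>j. p ^ k * d j) = 1 + of_nat p ^ Suc k * ((\<Sum>j<l. of_nat (d j) * x_pow j) + of_nat p * v)"
proof -
  obtain v where v: "unit_prod d = 1 + of_nat p * ((\<Sum>j<l. of_nat (d j) * x_pow j) + of_nat p * v)"
    using prod_one_plus_p_expand unfolding unit_prod_def by blast
  obtain w where "unit_prod d ^ (p ^ k) =
      1 + of_nat p ^ Suc k * ((\<Sum>j<l. of_nat (d j) * x_pow j) + of_nat p * v + of_nat p * w)"
    unfolding v using power_one_plus_p_prime_power[OF p_odd] by blast
  then have "unit_prod (\<lambda>j. p ^ k * d j) =
      1 + of_nat p ^ Suc k * ((\<Sum>j<l. of_nat (d j) * x_pow j) + of_nat p * (v + w))"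
    by (simp only: unit_prod_mult distrib_left add.assoc)
  then show ?thesis ..
qed

text \<open>If all exponents are \<open>p ^ a * d j\<close>, then the product is \<open>1 + p ^ (a + 1) * y\<close> with \<open>y\<close> congruent to
  \<open>\<Sum>j<l. d j * X ^ j\<close> modulo \<open>p\<close>; so if it is trivial modulo one more power of \<open>p\<close>, then
  \<open>p\<close> divides every \<open>d j\<close>.\<close>

lemma unit_prod_cong_1_imp_dvd:
  assumes "cong_pf (Suc a) (unit_prod c) 1" and "j < l"
  shows "p ^ a dvd c j"
  using assms
proof (induction a arbitrary: j)
  case 0
  show ?case by simp
next
  case (Suc a)
  have "cong_pf (Suc a) (unit_prod c) 1"
    using Suc.prems(1) by (rule cong_mod_mono) simp
  then have "\<forall>j\<in>{..<l}. \<exists>d. c j = p ^ a * d" using Suc.IH by (auto elim!: dvdE)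
  then obtain d where d: "\<And>j. j < l \<Longrightarrow> c j = p ^ a * d j" by (auto dest!: bchoice)
  define y where "y = (\<Sum>j<l. of_nat (d j) * x_pow j)"
  have "unit_prod c = unit_prod (\<lambda>j. p ^ a * d j)"
    by (simp add: unit_prod_def d)
  then obtain v where v: "unit_prod c = 1 + of_nat p ^ Suc a * (y + of_nat p * v)"
    using unit_prod_prime_power unfolding y_def by metis
  have "cong_pf (Suc (Suc a)) (of_nat p ^ Suc a * (y + of_nat p * v)) 0"
    using Suc.prems(1) unfolding v cong_mod_def by simp
  then have "cong_pf 1 (y + of_nat p * v) 0" by (rule cong_pf_cancel) simp
  moreover have "cong_pf 1 y (y + of_nat p * v)"
    by (rule cong_modI[of _ _ _ _ "- v" _ 0]) simp
  ultimately have "cong_pf 1 y 0" by (blast intro: cong_mod_trans)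
  then have "p dvd d j" unfolding y_def using Suc.prems(2) by (rule basis_mod_p_independent)
  then show ?case using d[OF Suc.prems(2)] by (simp add: mult.commute)
qed

lemma dvd_imp_unit_prod_cong_1:
  assumes "\<And>j. j < l \<Longrightarrow> p ^ a dvd c j"
  shows "cong_pf (Suc a) (unit_prod c) 1"
proof -
  from assms have "\<forall>j\<in>{..<l}. \<exists>d. c j = p ^ a * d" by (auto elim!: dvdE)
  then obtain d where d: "\<And>j. j < l \<Longrightarrow> c j = p ^ a * d j" by (auto dest!: bchoice)
  have "unit_prod c = unit_prod (\<lambda>j. p ^ a * d j)"
    by (simp add: unit_prod_def d)
  also have "\<dots> = unit_prod d ^ (p ^ a)" by (rule unit_prod_mult)
  finally show ?thesis
    using cong_mod_power_prime_power[OF unit_prod_cong_1, where k = a] by simp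
qed

lemma unit_prod_cong_iff:
  "cong_pf (Suc a) (unit_prod c) (unit_prod d) \<longleftrightarrow> (\<forall>j<l. [c j = d j] (mod p ^ a))"
proof -
  \<comment> \<open>The exponents \<open>e\<close> represent \<open>c - d\<close>, since those divisible by \<open>p ^ a\<close> act trivially.\<close>
  define e where "e j = c j + (p ^ a - 1) * d j" for j
  have pa: "p ^ a > 0" using p_gt_1 by simp
  then have pa': "(p ^ a - 1) * k + k = p ^ a * k" for k
    by (metis Suc_diff_1 add.commute mult_Suc)
  then have e: "e j + d j = c j + p ^ a * d j" for j by (simp only: e_def add.assoc)
  have 1: "cong_pf (Suc a) (unit_prod (\<lambda>j. p ^ a * d j)) 1"
    by (rule dvd_imp_unit_prod_cong_1) simp
  have "unit_prod e * unit_prod d = unit_prod c * unit_prod (\<lambda>j. p ^ a * d j)"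
    by (simp only: unit_prod_add[symmetric] e)
  with cong_mod_mult_left[OF 1, of "unit_prod c"]
  have 2: "cong_pf (Suc a) (unit_prod e * unit_prod d) (unit_prod c)" by simp
  have "cong_pf (Suc a) (unit_prod c) (unit_prod d) \<longleftrightarrow> cong_pf (Suc a) (unit_prod e) 1"
  proof
    assume "cong_pf (Suc a) (unit_prod e) 1"
    then have "cong_pf (Suc a) (unit_prod d * unit_prod e) (unit_prod d * 1)"
      by (rule cong_mod_mult_left)
    then have "cong_pf (Suc a) (unit_prod e * unit_prod d) (unit_prod d)"
      by (simp add: mult.commute)
    with 2 show "cong_pf (Suc a) (unit_prod c) (unit_prod d)"
      by (blast intro: cong_mod_trans cong_mod_sym)
  next
    assume *: "cong_pf (Suc a) (unit_prod c) (unit_prod d)"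
    define w where "w = unit_prod (\<lambda>j. (p ^ a - 1) * d j)"
    have "unit_prod e = w * unit_prod c"
      unfolding w_def e_def by (subst mult.commute) (rule unit_prod_add)
    moreover have "w * unit_prod d = unit_prod (\<lambda>j. p ^ a * d j)"
      unfolding w_def unit_prod_add[symmetric] pa' ..
    ultimately show "cong_pf (Suc a) (unit_prod e) 1"
      using cong_mod_trans[OF cong_mod_mult_left[OF *, of w]] 1 by simp
  qed
  also have "\<dots> \<longleftrightarrow> (\<forall>j<l. p ^ a dvd e j)"
    using unit_prod_cong_1_imp_dvd dvd_imp_unit_prod_cong_1 by blast
  also have "\<dots> \<longleftrightarrow> (\<forall>j<l. [c j = d j] (mod p ^ a))"
  proof -
    have "p ^ a dvd e j \<longleftrightarrow> [c j = d j] (mod p ^ a)" for j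
    proof -
      have "p ^ a dvd e j \<longleftrightarrow> [e j = 0] (mod p ^ a)" by (simp add: cong_0_iff)
      also have "\<dots> \<longleftrightarrow> [e j + d j = 0 + d j] (mod p ^ a)" by (simp only: cong_add_rcancel_nat)
      also have "\<dots> \<longleftrightarrow> [c j = d j] (mod p ^ a)" unfolding e by (simp add: cong_def)
      finally show ?thesis .
    qed
    then show ?thesis by simp
  qed
  finally show ?thesis .
qed

text \<open>Successive approximation: an error \<open>p ^ (a + 1) * u\<close> is corrected by the exponents \<open>p ^ a * d j\<close>,
  where \<open>\<Sum>j<l. d j * X ^ j\<close> is congruent to \<open>u\<close> modulo \<open>(p, f)\<close>.\<close>

lemma unit_prod_surj:
  assumes "cong_pf 1 z 1"
  shows "\<exists>c. cong_pf (Suc a) z (unit_prod c)"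
proof (induction a)
  case 0
  have "cong_pf 1 z (unit_prod (\<lambda>_. 0))" using assms by (simp add: unit_prod_def)
  then show ?case by auto
next
  case (Suc a)
  then obtain c where c: "cong_pf (Suc a) z (unit_prod c)" ..
  then obtain u v where z: "z = unit_prod c + of_nat p ^ Suc a * u + f * v"
    by (rule cong_modE)
  obtain d where d: "cong_pf 1 u (\<Sum>j<l. of_nat (d j) * x_pow j)"
    using basis_mod_p_spans by blast
  define y where "y = (\<Sum>j<l. of_nat (d j) * x_pow j)"
  obtain w where w: "unit_prod (\<lambda>j. p ^ a * d j) = 1 + of_nat p ^ Suc a * (y + of_nat p * w)"
    using unit_prod_prime_power unfolding y_def by blast
  have 1: "unit_prod (\<lambda>j. c j + p ^ a * d j)
      = unit_prod c + of_nat p ^ Suc a * (unit_prod c * (y + of_nat p * w))"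
    unfolding unit_prod_add w by (simp add: algebra_simps)
  have "cong_pf 1 (y + of_nat p * w) y"
    by (rule cong_modI[of _ _ _ _ w _ 0]) simp
  then have "cong_pf 1 (unit_prod c * (y + of_nat p * w)) (1 * y)"
    by (rule cong_mod_mult[OF unit_prod_cong_1])
  then have "cong_pf 1 u (unit_prod c * (y + of_nat p * w))"
    using cong_mod_trans[OF d[folded y_def] cong_mod_sym] by simp
  then have "cong_pf (Suc a + 1) (of_nat p ^ Suc a * u)
      (of_nat p ^ Suc a * (unit_prod c * (y + of_nat p * w)))"
    by (rule cong_mod_shift)
  then have "cong_pf (Suc a + 1) (unit_prod c + of_nat p ^ Suc a * u) (unit_prod (\<lambda>j. c j + p ^ a * d j))"
    unfolding 1 by (intro cong_mod_add) auto
  moreover have "cong_pf (Suc a + 1) z (unit_prod c + of_nat p ^ Suc a * u)"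
    by (rule cong_modI[of _ _ _ _ 0 _ v]) (simp add: z)
  ultimately show ?case by (auto intro: cong_mod_trans)
qed

end

section \<open>Bases of finite abelian \<open>p\<close>-groups\<close>

lemma (in group) nat_pow_eq_iff_cong:
  fixes m n :: nat
  assumes "x \<in> carrier G"
  shows "x [^] m = x [^] n \<longleftrightarrow> [m = n] (mod ord x)"
  using int_pow_eq[OF assms, of "int m" "int n"]
  by (metis cong_iff_dvd_diff cong_int_iff cong_sym_eq int_pow_int)

lemma (in comm_group) finprod_nat_pow_add:
  assumes "g \<in> A \<rightarrow> carrier G"
  shows "(\<Otimes>i\<in>A. g i [^] (c i + d i :: nat)) = (\<Otimes>i\<in>A. g i [^] c i) \<otimes> (\<Otimes>i\<in>A. g i [^] d i)"
proof -
  have "(\<Otimes>i\<in>A. g i [^] (c i + d i)) = (\<Otimes>i\<in>A. g i [^] c i \<otimes> g i [^] d i)"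
    using assms by (intro finprod_cong') (auto simp: nat_pow_mult Pi_iff)
  also have "\<dots> = (\<Otimes>i\<in>A. g i [^] c i) \<otimes> (\<Otimes>i\<in>A. g i [^] d i)"
    using assms by (intro finprod_multf) auto
  finally show ?thesis .
qed

lemma (in comm_group) finprod_nat_pow_mult:
  assumes "g \<in> A \<rightarrow> carrier G"
  shows "(\<Otimes>i\<in>A. g i [^] (k * c i :: nat)) = (\<Otimes>i\<in>A. g i [^] c i) [^] k"
proof (induction k)
  case 0
  then show ?case by simp
next
  case (Suc k)
  have "(\<Otimes>i\<in>A. g i [^] (Suc k * c i)) = (\<Otimes>i\<in>A. g i [^] (k * c i + c i))"
    by (simp add: add.commute)
  also have "\<dots> = (\<Otimes>i\<in>A. g i [^] c i) [^] Suc k"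
    unfolding finprod_nat_pow_add[OF assms] Suc by simp
  finally show ?case .
qed

text \<open>A finite abelian \<open>p\<close>-group is a direct product of cyclic groups of orders \<open>p ^ a i\<close>, \<open>i < m\<close>. Among
  the generating families of a fixed length \<open>m\<close>, one whose orders have the smallest sum is a basis:
  from a nontrivial relation a common power \<open>p ^ e\<close> can be split off all exponents, and one
  generator can be replaced by an element of order at most \<open>p ^ e\<close>. Members of order \<open>1\<close> are
  allowed, and \<open>a i = 0\<close> for \<open>i \<ge> m\<close>, in accordance with a trivial factor.\<close>

lemma (in comm_group) finite_p_group_basis:
  fixes p k :: nat
  assumes p: "Factorial_Ring.prime p" and fin: "finite (carrier G)" and order: "order G = p ^ k"
  obtains m :: nat and g :: "nat \<Rightarrow> 'a" and a :: "nat \<Rightarrow> nat"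
  where "g \<in> {..<m} \<rightarrow> carrier G"
    and "\<And>i. i \<ge> m \<Longrightarrow> a i = 0"
    and "\<And>x. x \<in> carrier G \<Longrightarrow> \<exists>c :: nat \<Rightarrow> nat. x = (\<Otimes>i\<in>{..<m}. g i [^] c i)"
    and "\<And>c d :: nat \<Rightarrow> nat. (\<Otimes>i\<in>{..<m}. g i [^] c i) = (\<Otimes>i\<in>{..<m}. g i [^] d i)
      \<longleftrightarrow> (\<forall>i<m. [c i = d i] (mod p ^ a i))"
proof -
  define m where "m = order G"
  define gen where "gen g \<longleftrightarrow> g \<in> {..<m} \<rightarrow> carrier G \<and>
    (\<forall>H. subgroup H G \<and> g ` {..<m} \<subseteq> H \<longrightarrow> H = carrier G)" for g :: "nat \<Rightarrow> 'a"
  obtain g0 where "bij_betw g0 {0..<m} (carrier G)"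
    unfolding m_def order_def using ex_bij_betw_nat_finite[OF fin] by blast
  then have g0: "g0 ` {..<m} = carrier G" by (simp add: bij_betw_def atLeast0LessThan)
  then have "gen g0" unfolding gen_def by (auto dest: subgroup.subset)
  then obtain g where g: "gen g" and min: "\<And>h. gen h \<Longrightarrow> (\<Sum>i<m. ord (g i)) \<le> (\<Sum>i<m. ord (h i))"
    using ex_has_least_nat[of gen g0 "\<lambda>g. \<Sum>i<m. ord (g i)"] by blast
  have gc: "g i \<in> carrier G" if "i < m" for i using g that by (auto simp: gen_def)
  then have gPi: "g \<in> {..<m} \<rightarrow> carrier G" by auto
  have "\<exists>b. ord (g i) = p ^ b" if "i < m" for i
    using ord_dvd_group_order[OF gc[OF that]] p unfolding order by (auto simp: divides_primepow_nat)
  then obtain b where b: "\<And>i. i < m \<Longrightarrow> ord (g i) = p ^ b i" by metis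
  define prd where "prd c = (\<Otimes>i\<in>{..<m}. g i [^] (c i :: nat))" for c
  have prd_closed: "prd c \<in> carrier G" for c
    unfolding prd_def using gc by (intro finprod_closed) auto
  have prd_cong: "prd c = prd d" if "\<And>i. i < m \<Longrightarrow> g i [^] c i = g i [^] d i" for c d
    unfolding prd_def using gc that by (intro finprod_cong') auto
  have prd_add: "prd (\<lambda>i. c i + d i) = prd c \<otimes> prd d" for c d
    unfolding prd_def by (rule finprod_nat_pow_add[OF gPi])
  have prd_mult: "prd (\<lambda>i. n * c i) = prd c [^] n" for n c
    unfolding prd_def by (rule finprod_nat_pow_mult[OF gPi])
  have m_pos: "m > 0" unfolding m_def order_def using fin one_closed by (auto simp: card_gt_0_iff)
  have pow_m: "x [^] m = \<one>" if "x \<in> carrier G" for x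
    unfolding m_def using pow_order_eq_1[OF that] .

  have surj: "\<exists>c. x = prd c" if "x \<in> carrier G" for x
  proof -
    have "subgroup (range prd) G"
    proof (rule subgroupI)
      fix x assume "x \<in> range prd"
      then obtain c where c: "x = prd c" by blast
      have "inv x = prd (\<lambda>i. (m - 1) * c i)"
      proof (rule inv_equality)
        have "x [^] (m - 1) \<otimes> x = x [^] m"
          using nat_pow_Suc[of x "m - 1"] m_pos by simp
        then show "prd (\<lambda>i. (m - 1) * c i) \<otimes> x = \<one>"
          using pow_m[OF prd_closed] by (simp add: prd_mult c)
      qed (auto simp: c prd_closed)
      then show "inv x \<in> range prd" by blast
    next
      fix x y assume "x \<in> range prd" "y \<in> range prd"
      then show "x \<otimes> y \<in> range prd" by (auto simp: prd_add[symmetric])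
    qed (use prd_closed in auto)
    moreover have "g i \<in> range prd" if "i < m" for i
    proof -
      have "prd (\<lambda>j. if j = i then 1 else 0) = (\<Otimes>j\<in>{..<m}. if j = i then g j else \<one>)"
        unfolding prd_def using gc by (intro finprod_cong') auto
      also have "\<dots> = g i" using gc that by (intro finprod_singleton_swap) auto
      finally show ?thesis by (metis rangeI)
    qed
    ultimately have "range prd = carrier G" using g unfolding gen_def by blast
    then show ?thesis using that by blast
  qed

  have rel: "p ^ b j dvd c j" if prd: "prd c = \<one>" and "j < m" for c j
  proof (rule ccontr)
    assume not_dvd: "\<not> p ^ b j dvd c j"
    define B where "B = {i. i < m \<and> \<not> p ^ b i dvd c i}"
    have "j \<in> B" using not_dvd \<open>j < m\<close> by (simp add: B_def)
    then obtain i where i: "i \<in> B" "\<And>i'. i' \<in> B \<Longrightarrow> multiplicity p (c i) \<le> multiplicity p (c i')"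
      using ex_has_least_nat[of "\<lambda>i. i \<in> B" j "\<lambda>i. multiplicity p (c i)"] by blast
    define e where "e = multiplicity p (c i)"
    have i': "i < m" "\<not> p ^ b i dvd c i" using i(1) by (auto simp: B_def)
    then have "c i \<noteq> 0" by (metis dvd_0_right)
    then obtain u where u: "c i = p ^ e * u" "\<not> p dvd u"
      using multiplicity_decompose'[of "c i" p] p unfolding e_def by (metis not_prime_unit mult.commute)
    \<comment> \<open>Exponents divisible by the order of their generator do not matter and become \<open>0\<close>.\<close>
    define d where "d i' = (if i' \<in> B then c i' div p ^ e else 0)" for i'
    have cd: "c i' = p ^ e * d i'" if "i' \<in> B" for i'
    proof -
      have "p ^ e dvd c i'" unfolding e_def by (rule multiplicity_dvd') (rule i(2)[OF that])
      then show ?thesis using that by (simp add: d_def)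
    qed
    have "e < b i"
    proof (rule ccontr)
      assume "\<not> e < b i"
      then have "p ^ b i dvd p ^ e" by (intro le_imp_power_dvd) simp
      then show False using i'(2) u(1) by simp
    qed
    define h where "h = prd d"
    have "h [^] (p ^ e) = prd c"
      unfolding h_def prd_mult[symmetric]
    proof (rule prd_cong)
      fix i' assume "i' < m"
      show "g i' [^] (p ^ e * d i') = g i' [^] c i'"
      proof (cases "i' \<in> B")
        case True then show ?thesis by (simp add: cd)
      next
        case False
        then have "ord (g i') dvd c i'" using \<open>i' < m\<close> by (simp add: B_def b)
        then have "g i' [^] c i' = \<one>" using pow_eq_id[OF gc[OF \<open>i' < m\<close>]] by blast
        then show ?thesis using False by (simp add: d_def)
      qed
    qed
    then have "ord h dvd p ^ e" using pow_eq_id[of h] prd prd_closed by (simp add: h_def)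
    then have "ord h \<le> p ^ e" using prime_gt_0_nat[OF p] by (intro dvd_imp_le) auto
    also have "\<dots> < ord (g i)"
      using \<open>e < b i\<close> prime_gt_1_nat[OF p] b[OF i'(1)] by simp
    finally have less: "ord h < ord (g i)" .
    \<comment> \<open>As \<open>d i = u\<close> is prime to \<open>p\<close>, the generator \<open>g i\<close> is recovered from \<open>h\<close> and the others.\<close>
    have "gen (g(i := h))"
      unfolding gen_def
    proof (intro conjI allI impI)
      show "g(i := h) \<in> {..<m} \<rightarrow> carrier G" using gc prd_closed by (auto simp: h_def)
    next
      fix H assume H: "subgroup H G \<and> g(i := h) ` {..<m} \<subseteq> H"
      then interpret H: subgroup H G by blast
      have gH: "g i' \<in> H" if "i' < m" "i' \<noteq> i" for i'
        using conjunct2[OF H] that by (auto simp: image_subset_iff split: if_splits)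
      have hH: "h \<in> H" using conjunct2[OF H] i'(1) by (auto simp: image_subset_iff)
      have powH: "x [^] n \<in> H" if "x \<in> H" for x and n :: nat
        using that by (induction n) auto
      define r where "r = (\<Otimes>i'\<in>{..<m} - {i}. g i' [^] d i')"
      have rH: "r \<in> H"
      proof -
        have "(\<Otimes>i'\<in>A. g i' [^] d i') \<in> H" if "finite A" "A \<subseteq> {..<m} - {i}" for A
          using that
        proof (induction A)
          case (insert x A)
          then show ?case
            by (subst finprod_insert) (auto intro!: H.m_closed powH gH gc nat_pow_closed)
        qed auto
        then show ?thesis unfolding r_def by auto
      qed
      have "h = (\<Otimes>i'\<in>insert i ({..<m} - {i}). g i' [^] d i')"
        unfolding h_def prd_def using i'(1) by (simp add: insert_absorb)
      also have "\<dots> = g i [^] d i \<otimes> r"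
        unfolding r_def using i'(1) gc by (intro finprod_insert) auto
      finally have "h \<otimes> inv r = g i [^] d i"
        using rH gc[OF i'(1)] by (simp add: m_assoc)
      then have "g i [^] d i \<in> H" using hH rH by (metis H.m_closed H.m_inv_closed)
      moreover have "d i = u"
        using u(1) i(1) prime_gt_0_nat[OF p] by (simp add: d_def)
      ultimately have guH: "g i [^] u \<in> H" by simp
      have "coprime u (ord (g i))"
        using u(2) p b[OF i'(1)] by (metis coprime_commute coprime_power_left_iff prime_imp_coprime)
      then obtain s where s: "[u * s = 1] (mod ord (g i))"
        using cong_solve_coprime_nat[of u "ord (g i)"] by auto
      have "(g i [^] u) [^] s = g i [^] (1::nat)"
        unfolding nat_pow_pow[OF gc[OF i'(1)]] using s gc[OF i'(1)]
        by (subst nat_pow_eq_iff_cong) auto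
      then have "g i [^] (1::nat) \<in> H" using powH[OF guH, of s] by (simp only:)
      then have "g i \<in> H" using gc[OF i'(1)] by simp
      then have "g ` {..<m} \<subseteq> H" using gH by blast
      then show "H = carrier G" using g H unfolding gen_def by blast
    qed
    then have "(\<Sum>i'<m. ord (g i')) \<le> (\<Sum>i'<m. ord ((g(i := h)) i'))" by (rule min)
    moreover have "(\<Sum>i'<m. ord ((g(i := h)) i')) < (\<Sum>i'<m. ord (g i'))"
      using i'(1) less by (intro sum_strict_mono_ex1) auto
    ultimately show False by simp
  qed

  have rel': "prd c = prd d \<longleftrightarrow> (\<forall>i<m. [c i = d i] (mod p ^ b i))" for c d
  proof
    assume eq: "prd c = prd d"
    \<comment> \<open>The group has order \<open>m\<close>, so the exponents \<open>e\<close> represent \<open>c - d\<close>.\<close>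
    define e where "e i = c i + (m - 1) * d i" for i
    have "prd e = prd d \<otimes> prd d [^] (m - 1)"
      unfolding e_def prd_add prd_mult eq ..
    also have "\<dots> = prd d [^] m"
      using nat_pow_Suc2[OF prd_closed, of d "m - 1"] m_pos by simp
    finally have "prd e = \<one>" using pow_m[OF prd_closed] by simp
    show "\<forall>i<m. [c i = d i] (mod p ^ b i)"
    proof (intro allI impI)
      fix i assume "i < m"
      have "p ^ b i dvd e i" by (rule rel) fact+
      then have 1: "[e i + d i = d i] (mod p ^ b i)" by (auto simp: cong_def elim!: dvdE)
      have "e i + d i = c i + m * d i"
        unfolding e_def using m_pos by (cases m) auto
      moreover have "p ^ b i dvd m"
        using ord_dvd_group_order[OF gc[OF \<open>i < m\<close>]] b[OF \<open>i < m\<close>] by (simp add: m_def)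
      then have "[c i + m * d i = c i] (mod p ^ b i)"
        by (auto simp: cong_def mult.assoc elim!: dvdE)
      ultimately show "[c i = d i] (mod p ^ b i)" using 1 by (metis cong_sym cong_trans)
    qed
  next
    assume "\<forall>i<m. [c i = d i] (mod p ^ b i)"
    then show "prd c = prd d"
      by (intro prd_cong) (simp add: nat_pow_eq_iff_cong gc b)
  qed
  show thesis
    by (rule that[of g m "\<lambda>i. if i < m then b i else 0"])
      (use gPi surj rel' in \<open>auto simp: prd_def\<close>)
qed

section \<open>Finite fields as quotients of \<open>\<int>[X]\<close>\<close>

context cring
begin

text \<open>Evaluation of an integer polynomial at \<open>x\<close>, by Horner's rule; an integer coefficient \<open>c\<close> acts
  as the multiple \<open>[c] \<cdot> \<one>\<close>.\<close>

definition int_poly_eval :: "'a \<Rightarrow> int poly \<Rightarrow> 'a" where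
  "int_poly_eval x = (\<lambda>a. fold_coeffs (\<lambda>c r. add_pow R c \<one> \<oplus> x \<otimes> r) a \<zero>)"

lemma add_pow_int_0 [simp]: "add_pow R (0::int) y = \<zero>"
  by (simp add: add_pow_def)

context
  fixes x assumes x [simp]: "x \<in> carrier R"
begin

lemma int_poly_eval_0 [simp]: "int_poly_eval x 0 = \<zero>"
  by (simp add: int_poly_eval_def)

lemma int_poly_eval_pCons [simp]:
  "int_poly_eval x (pCons c a) = add_pow R c \<one> \<oplus> x \<otimes> int_poly_eval x a"
  by (cases "c = 0 \<and> a = 0") (auto simp: int_poly_eval_def)

lemma int_poly_eval_closed [simp]: "int_poly_eval x a \<in> carrier R"
  by (induction a) auto

lemma int_poly_eval_1 [simp]: "int_poly_eval x 1 = \<one>"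
  by (simp add: one_pCons)

lemma int_poly_eval_add [simp]:
  "int_poly_eval x (a + b) = int_poly_eval x a \<oplus> int_poly_eval x b"
proof (induction a b rule: poly_induct2)
  case (pCons c a d b)
  have "add_pow R (c + d) \<one> = add_pow R c \<one> \<oplus> add_pow R d \<one>"
    by (rule add.int_pow_mult) simp
  with pCons show ?case by (simp add: r_distr a_ac)
qed simp

lemma int_poly_eval_smult [simp]:
  "int_poly_eval x (Polynomial.smult c a) = add_pow R c \<one> \<otimes> int_poly_eval x a"
proof (induction a)
  case (pCons d a)
  have "add_pow R (c * d) \<one> = add_pow R c \<one> \<otimes> add_pow R d \<one>"
    by (simp add: add_pow_ldistr_int add.int_pow_pow mult.commute)
  with pCons show ?case by (simp add: r_distr m_ac)
qed simp

lemma int_poly_eval_mult [simp]: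
  "int_poly_eval x (a * b) = int_poly_eval x a \<otimes> int_poly_eval x b"
  by (induction a) (auto simp: l_distr m_assoc)

lemma int_poly_eval_power [simp]: "int_poly_eval x (a ^ n) = int_poly_eval x a [^] n"
  by (induction n) (auto simp: m_comm)

lemma int_poly_eval_diff [simp]:
  "int_poly_eval x (a - b) = int_poly_eval x a \<ominus> int_poly_eval x b"
proof -
  have "int_poly_eval x a = int_poly_eval x (a - b) \<oplus> int_poly_eval x b"
    by (simp flip: int_poly_eval_add)
  then show ?thesis by (simp add: a_minus_def a_assoc r_neg)
qed

lemma int_poly_eval_monom_1 [simp]: "int_poly_eval x (Polynomial.monom 1 n) = x [^] n"
  by (induction n) (simp_all add: monom_0 monom_Suc m_comm)

lemma int_poly_eval_of_nat: "int_poly_eval x (of_nat n) = add_pow R (int n) \<one>"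
  by (simp add: of_nat_poly)

end

end

text \<open>The field with \<open>p ^ l\<close> elements is \<open>\<int>[X] / (p, f)\<close> for a monic \<open>f\<close> of degree \<open>l\<close>, with \<open>X\<close> mapped to a
  generator of the multiplicative group. The polynomial \<open>f\<close> is a monic polynomial of least degree
  \<open>d\<close> that vanishes at the generator; \<open>d = l\<close> follows by counting remainders modulo \<open>p\<close>.\<close>

lemma (in field) int_poly_presentation:
  fixes p l :: nat
  assumes p: "Factorial_Ring.prime p" and l: "l > 0" and card: "Coset.order R = p ^ l"
  obtains x f where "x \<in> carrier R"
    and "carrier R - {\<zero>} = range (\<lambda>i::nat. x [^] i)"
    and "x [^] (p ^ l) = x"
    and "Polynomial.lead_coeff f = 1" and "Polynomial.degree f = l"
    and "\<And>a. int_poly_eval x a = \<zero> \<longleftrightarrow> (\<exists>b c. a = of_nat p * b + f * c)"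
proof -
  have fin: "finite (carrier R)"
    using card prime_gt_0_nat[OF p] by (intro card_ge_0_finite) (simp add: Coset.order_def)
  obtain x where xm: "x \<in> carrier (Multiplicative_Group.mult_of R)"
    and gen: "carrier (Multiplicative_Group.mult_of R) = {x [^] i | i::nat. i \<in> UNIV}"
    using finite_field_mult_group_has_gen[OF fin] by (elim bexE)
  have x [simp]: "x \<in> carrier R" and x0: "x \<noteq> \<zero>" using xm by auto
  have gen': "carrier R - {\<zero>} = range (\<lambda>i::nat. x [^] i)" using gen by auto
  let ?e = "int_poly_eval x"
  have "p ^ l > 1" using prime_gt_1_nat[OF p] l by (rule one_less_power)
  have "add_pow R (int (p ^ l)) \<one> = \<zero>"
    using add.pow_order_eq_1[OF one_closed] card by (simp add: Coset.order_def add_pow_int_ge del: of_nat_power)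
  then have "?e (of_nat p ^ l) = \<zero>" by (simp only: int_poly_eval_of_nat[OF x] flip: of_nat_power)
  then have "?e (of_nat p) [^] l = \<zero>" by simp
  moreover have "a = \<zero>" if "a [^] n = \<zero>" "a \<in> carrier R" for a and n :: nat
    using that by (induction n) (auto simp: integral_iff)
  ultimately have p0: "?e (of_nat p) = \<zero>" by simp
  have p_mult: "?e (of_nat p * b) = \<zero>" for b by (simp add: p0)
  have "x [^] (p ^ l - 1) = \<one>"
  proof -
    interpret M: group "Multiplicative_Group.mult_of R" by (rule field_mult_group)
    have "Coset.order (Multiplicative_Group.mult_of R) = p ^ l - 1" using order_mult_of[OF fin] card by simp
    then show ?thesis using M.pow_order_eq_1[OF xm] by (simp add: Multiplicative_Group.nat_pow_mult_of)
  qed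
  moreover have "Suc (p ^ l - 1) = p ^ l" using \<open>p ^ l > 1\<close> by simp
  ultimately have x_pow_q: "x [^] (p ^ l) = x" using nat_pow_Suc2[OF x, of "p ^ l - 1"] by simp
  define Q where "Q d \<longleftrightarrow> (\<exists>f. Polynomial.lead_coeff f = 1 \<and> Polynomial.degree f = d \<and> ?e f = \<zero>)" for d
  have "Q (p ^ l)"
  proof -
    let ?f = "Polynomial.monom 1 (p ^ l) - Polynomial.monom 1 1 :: int poly"
    have coeff: "poly.coeff ?f (p ^ l) = 1" using \<open>p ^ l > 1\<close> by simp
    have deg: "Polynomial.degree ?f = p ^ l"
    proof (rule antisym)
      show "Polynomial.degree ?f \<le> p ^ l"
        using \<open>p ^ l > 1\<close> by (intro degree_diff_le) (auto simp: Polynomial.degree_monom_eq)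
      show "p ^ l \<le> Polynomial.degree ?f" using coeff by (intro le_degree) simp
    qed
    have "?e ?f = \<zero>" using x_pow_q by simp
    moreover have "Polynomial.lead_coeff ?f = 1" unfolding deg by (rule coeff)
    ultimately show ?thesis unfolding Q_def using deg by blast
  qed
  define d where "d = (LEAST d. Q d)"
  have "Q d" unfolding d_def by (rule LeastI) fact
  have least: "d \<le> k" if "Q k" for k unfolding d_def using that by (rule Least_le)
  obtain f where f: "Polynomial.lead_coeff f = 1" "Polynomial.degree f = d" "?e f = \<zero>"
    using \<open>Q d\<close> unfolding Q_def by blast
  have "d > 0"
  proof (rule ccontr)
    assume "\<not> d > 0"
    then obtain c where "f = [:c:]" using f(2) by (auto elim: degree_eq_zeroE)
    then have "f = 1" using f(1) by (simp add: one_pCons)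
    then show False using f(3) by simp
  qed
  \<comment> \<open>A leading coefficient prime to \<open>p\<close> could be made \<open>1\<close> modulo \<open>p\<close>, against the minimality of \<open>d\<close>;
    so it is divisible by \<open>p\<close>, and the leading term can be removed.\<close>
  have small: "\<exists>b. a = of_nat p * b" if "?e a = \<zero>" "Polynomial.degree a < d" for a
    using that
  proof (induction "Polynomial.degree a" arbitrary: a rule: less_induct)
    case less
    define n where "n = Polynomial.degree a"
    define c where "c = Polynomial.lead_coeff a"
    have p_dvd: "int p dvd c"
    proof (rule ccontr)
      assume "\<not> int p dvd c"
      then have "coprime c (int p)"
        using prime_imp_coprime[of "int p" c] p by (simp add: coprime_commute)
      then obtain s where "[c * s = 1] (mod int p)" using cong_solve_coprime_int[of c "int p"] by auto
      then obtain t where t: "c * s - 1 = int p * t" by (metis cong_iff_dvd_diff dvd_def)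
      let ?g = "Polynomial.smult s a - of_nat p * Polynomial.monom t n"
      have "?e ?g = \<zero>" using less.prems(1) p_mult by simp
      moreover have lc: "poly.coeff ?g n = 1"
        using t by (simp add: of_nat_poly c_def n_def algebra_simps)
      moreover have "Polynomial.degree ?g \<le> n"
        by (intro degree_diff_le) (auto simp: n_def of_nat_poly Polynomial.smult_monom degree_monom_le
            intro: order_trans[OF degree_smult_le])
      then have "Polynomial.degree ?g = n"
        using lc by (intro antisym le_degree) auto
      ultimately have "Q n" unfolding Q_def by metis
      then show False using least[of n] less.prems(2) by (simp add: n_def)
    qed
    then obtain t where t: "c = int p * t" by blast
    define a' where "a' = a - of_nat p * Polynomial.monom t n"
    have ea': "?e a' = \<zero>" unfolding a'_def using less.prems(1) p_mult by simp
    have a': "a = of_nat p * Polynomial.monom t n + a'" by (simp add: a'_def)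
    have coeff_n: "poly.coeff a' n = 0" using t by (simp add: a'_def of_nat_poly c_def n_def)
    have deg_a': "Polynomial.degree a' \<le> n"
      unfolding a'_def by (intro degree_diff_le) (auto simp: n_def of_nat_poly Polynomial.smult_monom degree_monom_le)
    show ?case
    proof (cases "a' = 0")
      case True
      then show ?thesis using a' by auto
    next
      case False
      then have "Polynomial.degree a' \<noteq> n" using coeff_n by (metis leading_coeff_0_iff)
      then have "Polynomial.degree a' < Polynomial.degree a" using deg_a' by (simp add: n_def)
      with less.hyps[of a'] ea' less.prems(2) obtain b where "a' = of_nat p * b" by auto
      then have "a = of_nat p * (Polynomial.monom t n + b)" using a' by (simp add: distrib_left)
      then show ?thesis ..
    qed
  qed
  have division: "\<exists>q r. a = f * q + r \<and> Polynomial.degree r < d" for a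
    using int_poly_monic_division[OF f(1)] f(2) \<open>d > 0\<close> by metis
  have ker: "?e a = \<zero> \<longleftrightarrow> (\<exists>b c. a = of_nat p * b + f * c)" for a
  proof
    assume a: "?e a = \<zero>"
    obtain q r where qr: "a = f * q + r" "Polynomial.degree r < d" using division by blast
    then have "?e r = \<zero>" using a f(3) by simp
    then obtain b where "r = of_nat p * b" using small[OF _ qr(2)] by blast
    then have "a = of_nat p * b + f * q" using qr(1) by simp
    then show "\<exists>b c. a = of_nat p * b + f * c" by blast
  qed (use p_mult f(3) in auto)
  have "d = l"
  proof -
    let ?L = "{xs. set xs \<subseteq> {0..<int p} \<and> length xs = d}"
    have "bij_betw (\<lambda>xs. ?e (Poly xs)) ?L (carrier R)"
    proof (rule bij_betw_imageI)
      show "inj_on (\<lambda>xs. ?e (Poly xs)) ?L"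
      proof (rule inj_onI)
        fix xs ys assume L: "xs \<in> ?L" "ys \<in> ?L" and "?e (Poly xs) = ?e (Poly ys)"
        then have "?e (Poly xs - Poly ys) = \<zero>" by simp
        moreover have "Polynomial.degree (Poly xs - Poly ys) < d"
          using L \<open>d > 0\<close> degree_Poly[of xs] degree_Poly[of ys]
          by (intro degree_lessI) (auto simp: nth_default_def)
        ultimately obtain b where b: "Poly xs - Poly ys = of_nat p * b" using small by blast
        show "xs = ys"
        proof (rule nth_equalityI)
          show "length xs = length ys" using L by simp
          fix i assume "i < length xs"
          then have i: "xs ! i \<in> {0..<int p}" "ys ! i \<in> {0..<int p}"
            using L by (auto dest!: nth_mem[of i] simp: subset_iff)
          have "xs ! i - ys ! i = int p * poly.coeff b i"
            using arg_cong[OF b, of "\<lambda>t. poly.coeff t i"] \<open>i < length xs\<close> L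
            by (simp add: of_nat_poly nth_default_def)
          then have "[xs ! i = ys ! i] (mod int p)" by (simp add: cong_iff_dvd_diff)
          then show "xs ! i = ys ! i" using i by (intro cong_less_imp_eq_int) auto
        qed
      qed
      have "carrier R \<subseteq> (\<lambda>xs. ?e (Poly xs)) ` ?L"
      proof
        fix y assume "y \<in> carrier R"
        then obtain a where a: "y = ?e a"
          using gen' int_poly_eval_0[OF x] int_poly_eval_monom_1[OF x] by (cases "y = \<zero>") (metis Diff_iff rangeE singletonD)+
        obtain q r where qr: "a = f * q + r" "Polynomial.degree r < d" using division by blast
        define xs where "xs = map (\<lambda>i. poly.coeff r i mod int p) [0..<d]"
        have "xs \<in> ?L" using prime_gt_0_nat[OF p] by (auto simp: xs_def)
        moreover have "r = Poly xs + of_nat p * Poly (map (\<lambda>i. poly.coeff r i div int p) [0..<d])"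
          by (rule poly_eqI) (use qr(2) in \<open>auto simp: xs_def nth_default_def of_nat_poly coeff_eq_0\<close>)
        then have "?e r = ?e (Poly xs)"
          by (metis int_poly_eval_add int_poly_eval_closed p_mult r_zero x)
        then have "y = ?e (Poly xs)" using a qr(1) f(3) by simp
        ultimately show "y \<in> (\<lambda>xs. ?e (Poly xs)) ` ?L" by blast
      qed
      then show "(\<lambda>xs. ?e (Poly xs)) ` ?L = carrier R" by auto
    qed
    then have "card ?L = p ^ l" using card by (simp add: bij_betw_same_card Coset.order_def)
    then have "p ^ d = p ^ l" by (simp add: card_lists_length_eq)
    then show ?thesis using prime_gt_1_nat[OF p] by simp
  qed
  show thesis
    by (rule that[OF x gen' x_pow_q f(1) _ ker]) (simp add: f(2) \<open>d = l\<close>)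
qed

section \<open>Images of a common cover, finite quotients and local rings\<close>

lemma iso_of_common_cover:
  fixes f :: "'x \<Rightarrow> 'g" and g :: "'x \<Rightarrow> 'h" and add :: "'x \<Rightarrow> 'x \<Rightarrow> 'x"
  assumes f: "range f = carrier G" "\<And>x y. f (add x y) = f x \<otimes>\<^bsub>G\<^esub> f y"
    and g: "range g = carrier H" "\<And>x y. g (add x y) = g x \<otimes>\<^bsub>H\<^esub> g y"
    and eq: "\<And>x y. f x = f y \<longleftrightarrow> g x = g y"
  shows "G \<cong> H"
proof -
  define h where "h u = g (inv_into UNIV f u)" for u
  have h: "h (f x) = g x" for x
    unfolding h_def using f_inv_into_f[of "f x" f UNIV] eq by auto
  have "h \<in> hom G H"
    unfolding hom_def using f g h by (auto simp flip: f(1) g(1) f(2) g(2))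
  moreover have "bij_betw h (carrier G) (carrier H)"
    unfolding bij_betw_def inj_on_def f(1)[symmetric] g(1)[symmetric]
    using h eq by (auto simp: image_image)
  ultimately show ?thesis unfolding is_iso_def iso_def by auto
qed

lemma (in cring) finite_imp_artinian:
  assumes "finite (carrier R)"
  shows "artinian_ring R"
proof (unfold_locales)
  fix I :: "nat \<Rightarrow> 'a set"
  assume I: "\<And>n. ideal (I n) R" and dec: "\<And>n. I (Suc n) \<subseteq> I n"
  obtain N where N: "\<And>n. card (I N) \<le> card (I n)"
    using ex_has_least_nat[of "\<lambda>_. True" 0 "\<lambda>n. card (I n)"] by auto
  have "I n = I N" if "n \<ge> N" for n
  proof (rule card_seteq)
    show "finite (I N)"
      using I[of N] assms by (metis additive_subgroup.a_subset finite_subset ideal.axioms(1))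
    show "I n \<subseteq> I N" using dec that by (rule lift_Suc_antimono_le)
    show "card (I N) \<le> card (I n)" by (rule N)
  qed
  then show "\<exists>N. \<forall>n\<ge>N. I n = I N" by blast
qed

lemma (in cring) local_ringI:
  assumes M: "ideal M R" and one: "\<one> \<notin> M" and units: "carrier R - M \<subseteq> Units R"
  shows "local_ring R"
proof (unfold_locales, rule ex1I)
  interpret M: ideal M R by (rule M)
  have proper: "J \<subseteq> M" if J: "ideal J R" and "J \<noteq> carrier R" for J
  proof
    fix u assume u: "u \<in> J"
    interpret J: ideal J R by (rule J)
    show "u \<in> M"
    proof (rule ccontr)
      assume "u \<notin> M"
      then have uU: "u \<in> Units R" using units J.Icarr[OF u] by blast
      then have "\<one> \<in> J" using J.I_l_closed[OF u Units_inv_closed[OF uU]] by simp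
      then show False using J.one_imp_carrier that by simp
    qed
  qed
  show "maximalideal M R"
  proof (rule maximalidealI[OF M])
    show "carrier R \<noteq> M" using one by auto
  next
    fix J assume "ideal J R" "M \<subseteq> J" "J \<subseteq> carrier R"
    then show "J = M \<or> J = carrier R" using proper by blast
  qed
  fix M' assume "maximalideal M' R"
  then interpret M': maximalideal M' R .
  have "M' \<subseteq> M" using proper[OF M'.is_ideal] M'.I_notcarr by auto
  then show "M' = M" using M'.I_maximal[OF M] one M.a_subset by auto
qed

text \<open>The quotient of a subring \<open>S\<close> of a commutative ring type by an ideal \<open>J\<close> of \<open>S\<close>, realised on natural
  numbers when it is finite. Finiteness is witnessed by a finite set \<open>T\<close> that meets all classes.\<close>

lemma ex_finite_quotient_ring:
  fixes S J T :: "'r::comm_ring_1 set"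
  assumes S: "1 \<in> S" "\<And>u v. u \<in> S \<Longrightarrow> v \<in> S \<Longrightarrow> u - v \<in> S" "\<And>u v. u \<in> S \<Longrightarrow> v \<in> S \<Longrightarrow> u * v \<in> S"
    and J: "J \<subseteq> S" "0 \<in> J" "\<And>u v. u \<in> J \<Longrightarrow> v \<in> J \<Longrightarrow> u - v \<in> J" "\<And>u v. u \<in> S \<Longrightarrow> v \<in> J \<Longrightarrow> u * v \<in> J"
    and T: "finite T" "\<And>u. u \<in> S \<Longrightarrow> \<exists>t\<in>T. u - t \<in> J"
  obtains A :: "nat ring" and h :: "'r \<Rightarrow> nat"
  where "cring A" and "finite (carrier A)" and "h ` S = carrier A"
    and "\<And>u v. u \<in> S \<Longrightarrow> v \<in> S \<Longrightarrow> h (u + v) = h u \<oplus>\<^bsub>A\<^esub> h v"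
    and "\<And>u v. u \<in> S \<Longrightarrow> v \<in> S \<Longrightarrow> h (u * v) = h u \<otimes>\<^bsub>A\<^esub> h v"
    and "h 1 = \<one>\<^bsub>A\<^esub>" and "h 0 = \<zero>\<^bsub>A\<^esub>"
    and "\<And>u v. u \<in> S \<Longrightarrow> v \<in> S \<Longrightarrow> h u = h v \<longleftrightarrow> u - v \<in> J"
proof -
  have S0: "0 \<in> S" using S(2)[OF S(1) S(1)] by simp
  have Sneg: "- u \<in> S" if "u \<in> S" for u using S(2)[OF S0 that] by simp
  have Sadd: "u + v \<in> S" if "u \<in> S" "v \<in> S" for u v using S(2)[OF that(1) Sneg[OF that(2)]] by simp
  have Jneg: "- u \<in> J" if "u \<in> J" for u using J(3)[OF J(2) that] by simp
  have Jadd: "u + v \<in> J" if "u \<in> J" "v \<in> J" for u v using J(3)[OF that(1) Jneg[OF that(2)]] by simp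
  have Jright: "v * u \<in> J" if "u \<in> S" "v \<in> J" for u v using J(4)[OF that] by (simp add: mult.commute)
  define R :: "'r ring" where "R = \<lparr>carrier = S, monoid.mult = (*), one = 1, zero = 0, add = (+)\<rparr>"
  interpret R: cring R
  proof (rule cringI)
    show "abelian_group R"
    proof (rule abelian_groupI)
      fix u assume "u \<in> carrier R"
      then show "\<exists>v\<in>carrier R. v \<oplus>\<^bsub>R\<^esub> u = \<zero>\<^bsub>R\<^esub>"
        using Sneg by (intro bexI[of _ "- u"]) (auto simp: R_def)
    qed (auto simp: R_def S0 Sadd algebra_simps)
    show "comm_monoid R"
      by (rule comm_monoidI) (auto simp: R_def S algebra_simps)
  qed (auto simp: R_def algebra_simps)
  have minus: "u \<ominus>\<^bsub>R\<^esub> v = u - v" if "u \<in> S" "v \<in> S" for u v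
  proof -
    have "\<ominus>\<^bsub>R\<^esub> v = - v" by (rule R.minus_equality) (use that Sneg in \<open>auto simp: R_def\<close>)
    then show ?thesis by (simp add: a_minus_def R_def)
  qed
  have J_ideal: "ideal J R"
  proof (rule idealI[OF R.ring_axioms])
    show "subgroup J (add_monoid R)"
    proof (rule group.subgroupI[OF R.add.is_group])
      fix u assume u: "u \<in> J"
      then have "\<ominus>\<^bsub>R\<^esub> u = - u"
        by (intro R.minus_equality) (use J(1) Sneg in \<open>auto simp: R_def\<close>)
      then show "inv\<^bsub>add_monoid R\<^esub> u \<in> J" using Jneg[OF u] by (simp add: a_inv_def)
    qed (use J Jadd in \<open>auto simp: R_def\<close>)
  qed (use J Jright in \<open>auto simp: R_def\<close>)
  obtain enc :: "'r \<Rightarrow> nat" where enc: "inj_on enc T"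
    using finite_imp_inj_to_nat_seg[OF T(1)] by blast
  define r where "r u = (SOME t. t \<in> T \<and> u - t \<in> J)" for u
  have r: "r u \<in> T" "u - r u \<in> J" if "u \<in> S" for u
    using someI_ex[OF T(2)[OF that, unfolded Bex_def]] unfolding r_def by auto
  have r_eq: "r u = r v \<longleftrightarrow> u - v \<in> J" if "u \<in> S" "v \<in> S" for u v
  proof
    assume "r u = r v"
    then show "u - v \<in> J" using J(3)[OF r(2)[OF that(1)] r(2)[OF that(2)]] by simp
  next
    assume uv: "u - v \<in> J"
    have "u - t \<in> J \<longleftrightarrow> v - t \<in> J" for t
      using J(3)[OF _ uv, of "u - t"] Jadd[OF _ uv, of "v - t"] by auto
    then show "r u = r v" by (simp add: r_def)
  qed
  define h where "h = enc \<circ> r"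
  have h_eq: "h u = h v \<longleftrightarrow> u - v \<in> J" if "u \<in> S" "v \<in> S" for u v
    using r_eq[OF that] inj_onD[OF enc, of "r u" "r v"] r(1)[OF that(1)] r(1)[OF that(2)]
    by (auto simp: h_def)
  have weak: "weak_ring_morphism h J R"
    by (rule weak_ring_morphismI[OF J_ideal]) (simp add: minus h_eq R_def[THEN arg_cong[of _ _ carrier]])
  have hom: "h \<in> ring_hom R (image_ring h R)"
    by (rule R.weak_ring_morphism_is_hom[OF weak])
  show thesis
  proof (rule that[of "image_ring h R" h])
    interpret Q: ring "image_ring h R" by (rule R.image_ring_is_ring[OF weak])
    show "cring (image_ring h R)"
    proof (intro cring.intro Q.ring_axioms Q.monoid_comm_monoidI)
      fix y z assume "y \<in> carrier (image_ring h R)" "z \<in> carrier (image_ring h R)"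
      then obtain u v where "y = h u" "z = h v" "u \<in> carrier R" "v \<in> carrier R"
        by (auto simp: image_ring_carrier)
      then show "y \<otimes>\<^bsub>image_ring h R\<^esub> z = z \<otimes>\<^bsub>image_ring h R\<^esub> y"
        using ring_hom_mult[OF hom] R.m_comm by metis
    qed
    show "h ` S = carrier (image_ring h R)" by (simp add: image_ring_carrier R_def)
    have "carrier (image_ring h R) \<subseteq> enc ` T"
      using r(1) by (auto simp: image_ring_carrier R_def h_def)
    then show "finite (carrier (image_ring h R))" using T(1) finite_surj by blast
    show "h (u + v) = h u \<oplus>\<^bsub>image_ring h R\<^esub> h v" if "u \<in> S" "v \<in> S" for u v
      using ring_hom_add[OF hom, of u v] that by (simp add: R_def)
    show "h (u * v) = h u \<otimes>\<^bsub>image_ring h R\<^esub> h v" if "u \<in> S" "v \<in> S" for u v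
      using ring_hom_mult[OF hom, of u v] that by (simp add: R_def)
  qed (simp_all add: h_eq image_ring_one image_ring_zero, simp_all add: R_def)
qed

section \<open>The fibre product of Galois rings\<close>

text \<open>Here \<open>F\<close> is the residue field and \<open>x\<close> the image of \<open>X\<close> in it. The components of the fibre product
  are indexed by all natural numbers. A component with \<open>a i = 0\<close> is a copy of the residue field and
  so adds nothing; hence only finitely many components matter when almost all \<open>a i\<close> vanish.\<close>

locale residue_presentation = monic_modulus f p l + field F
  for f :: "int poly" and p l :: nat and F (structure) +
  fixes x and a :: "nat \<Rightarrow> nat" and N :: nat
  assumes x_closed [simp]: "x \<in> carrier F"
    and generator: "carrier F - {\<zero>} = range (\<lambda>i::nat. x [^] i)"
    and kernel: "\<And>b. int_poly_eval x b = \<zero> \<longleftrightarrow> (\<exists>c d. b = of_nat p * c + f * d)"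
    and Frobenius_N: "x [^] (p ^ N) = x"
    and a_le_N: "\<And>i. a i \<le> N"
begin

abbreviation phi :: "int poly \<Rightarrow> 'a" where "phi \<equiv> int_poly_eval x"

lemma phi_eq_iff: "phi b = phi c \<longleftrightarrow> cong_pf 1 b c"
proof -
  have "phi b = phi c \<longleftrightarrow> phi (b - c) = \<zero>" by simp
  then show ?thesis unfolding kernel cong_mod_def by simp
qed

lemma phi_unit_prod [simp]: "phi (unit_prod c) = \<one>"
  using unit_prod_cong_1[of c] by (simp flip: phi_eq_iff del: One_nat_def)

lemma x_pow_ne_zero: "x [^] (c::nat) \<noteq> \<zero>"
  using generator by blast

text \<open>The fibre product before reduction: the families of polynomials with a common residue.\<close>

definition fibre :: "(nat \<Rightarrow> int poly) set" where
  "fibre = {u. \<forall>i. phi (u i) = phi (u 0)}"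

text \<open>The families that vanish in the product of the rings \<open>\<int>[X] / (p ^ (a i + 1), f)\<close>. The class of a
  family in \<open>fibre\<close> modulo this ideal is an element of the ring to be constructed.\<close>

definition fibre_ideal :: "(nat \<Rightarrow> int poly) set" where
  "fibre_ideal = {u. \<forall>i. cong_pf (Suc (a i)) (u i) 0}"

lemma fibreD: "u \<in> fibre \<Longrightarrow> phi (u i) = phi (u 0)"
  by (simp add: fibre_def)

lemma fibre_0: "0 \<in> fibre" and fibre_1: "1 \<in> fibre"
  by (simp_all add: fibre_def)

lemma
  assumes "u \<in> fibre" and "v \<in> fibre"
  shows fibre_add: "u + v \<in> fibre" and fibre_diff: "u - v \<in> fibre" and fibre_mult: "u * v \<in> fibre"
proof -
  obtain y z where "\<And>i. phi (u i) = y" "\<And>i. phi (v i) = z"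
    using assms by (metis fibreD)
  then have "phi ((u + v) i) = phi ((u + v) 0)" "phi ((u - v) i) = phi ((u - v) 0)"
      "phi ((u * v) i) = phi ((u * v) 0)" for i
    by (simp_all only: plus_fun_apply minus_apply times_fun_apply
      int_poly_eval_add int_poly_eval_diff int_poly_eval_mult x_closed)
  then show "u + v \<in> fibre" "u - v \<in> fibre" "u * v \<in> fibre"
    unfolding fibre_def by blast+
qed

lemma fibre_uminus: "u \<in> fibre \<Longrightarrow> - u \<in> fibre"
  using fibre_diff[OF fibre_0, of u] by simp

lemma phi_uminus: "phi (- b) = \<ominus> phi b"
  using int_poly_eval_diff[OF x_closed, of 0 b] by (simp add: a_minus_def)

lemma fibre_ideal_phi: "u \<in> fibre_ideal \<Longrightarrow> phi (u i) = \<zero>"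
  using phi_eq_iff[of "u i" 0] cong_mod_mono[of f p "Suc (a i)" "u i" 0 1]
  by (simp add: fibre_ideal_def)

lemma diff_in_fibre_ideal: "u - v \<in> fibre_ideal \<longleftrightarrow> (\<forall>i. cong_pf (Suc (a i)) (u i) (v i))"
  by (simp add: fibre_ideal_def cong_mod_def)

text \<open>A representative of the Teichmueller lift of \<open>x ^ c\<close>: the factor \<open>p ^ N\<close> in the exponent leaves the
  residue unchanged and makes the class depend only on the residue.\<close>

definition teichmueller :: "nat \<Rightarrow> int poly" where
  "teichmueller c = x_pow (p ^ N * c)"

lemma phi_teichmueller [simp]: "phi (teichmueller c) = x [^] c"
  by (simp add: teichmueller_def Frobenius_N flip: nat_pow_pow)

lemma teichmueller_add: "teichmueller (c + d) = teichmueller c * teichmueller d"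
  by (simp add: teichmueller_def mult_monom distrib_left)

lemma teichmueller_cong:
  assumes "x [^] c = x [^] d"
  shows "cong_pf (Suc (a i)) (teichmueller c) (teichmueller d)"
proof -
  have "cong_pf 1 (x_pow c) (x_pow d)" using assms by (simp flip: phi_eq_iff del: One_nat_def)
  then have "cong_pf (Suc N) (x_pow c ^ (p ^ N)) (x_pow d ^ (p ^ N))"
    by (rule cong_mod_power_prime_power)
  then have "cong_pf (Suc N) (teichmueller c) (teichmueller d)"
    by (simp add: teichmueller_def monom_power mult.commute)
  then show ?thesis by (rule cong_mod_mono) (simp add: a_le_N)
qed

lemma teichmueller_inverse:
  obtains d where "x [^] c \<otimes> x [^] d = \<one>"
    and "\<And>i. cong_pf (Suc (a i)) (teichmueller c * teichmueller d) 1"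
proof -
  have "x [^] c \<in> carrier F - {\<zero>}" using x_pow_ne_zero by simp
  then have "inv (x [^] c) \<in> carrier F - {\<zero>}" and inv: "x [^] c \<otimes> inv (x [^] c) = \<one>"
    by (simp_all add: field_Units flip: field_Units)
  then obtain d :: nat where d: "inv (x [^] c) = x [^] d" unfolding generator by blast
  then have *: "x [^] c \<otimes> x [^] d = \<one>" using inv by simp
  then have "x [^] (c + d) = x [^] (0::nat)" by (simp add: nat_pow_mult)
  then have "cong_pf (Suc (a i)) (teichmueller c * teichmueller d) 1" for i
    using teichmueller_cong[of "c + d" 0 i] by (simp add: teichmueller_add) (simp add: teichmueller_def)
  with * show thesis by (rule that)
qed

text \<open>The map from exponents to units: the Teichmueller factor is common to all components, and
  \<open>e i\<close> gives the principal unit in component \<open>i\<close>.\<close>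

definition lift :: "nat \<times> (nat \<Rightarrow> nat \<Rightarrow> nat) \<Rightarrow> nat \<Rightarrow> int poly" where
  "lift = (\<lambda>(c, e) i. teichmueller c * unit_prod (e i))"

text \<open>Addition of exponents.\<close>

definition exp_add :: "nat \<times> (nat \<Rightarrow> nat \<Rightarrow> nat) \<Rightarrow> nat \<times> (nat \<Rightarrow> nat \<Rightarrow> nat) \<Rightarrow> nat \<times> (nat \<Rightarrow> nat \<Rightarrow> nat)" where
  "exp_add = (\<lambda>(c, e) (c', e'). (c + c', \<lambda>i j. e i j + e' i j))"

lemma phi_lift: "phi (lift (c, e) i) = x [^] c"
  by (simp add: lift_def)

lemma lift_in_fibre: "lift z \<in> fibre"
  by (cases z) (simp add: fibre_def phi_lift)

lemma lift_exp_add: "lift (exp_add y z) = lift y * lift z"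
  by (auto simp: lift_def exp_add_def teichmueller_add unit_prod_add mult_ac split: prod.splits)

lemma lift_0: "lift (0, \<lambda>i j. 0) = 1"
  by (auto simp: lift_def teichmueller_def unit_prod_def)

lemma lift_cong_iff:
  "lift (c, e) - lift (c', e') \<in> fibre_ideal \<longleftrightarrow>
    x [^] c = x [^] c' \<and> (\<forall>i. \<forall>j<l. [e i j = e' i j] (mod p ^ a i))"
proof
  assume *: "lift (c, e) - lift (c', e') \<in> fibre_ideal"
  then have i: "cong_pf (Suc (a i)) (lift (c, e) i) (lift (c', e') i)" for i
    by (simp add: diff_in_fibre_ideal)
  have "cong_pf 1 (lift (c, e) 0) (lift (c', e') 0)"
    by (rule cong_mod_mono[OF i]) simp
  then have c: "x [^] c = x [^] c'" by (simp add: phi_lift flip: phi_eq_iff del: One_nat_def)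
  obtain d where d: "\<And>i. cong_pf (Suc (a i)) (teichmueller c * teichmueller d) 1"
    using teichmueller_inverse[of c] by blast
  have "cong_pf (Suc (a i)) (unit_prod (e i)) (unit_prod (e' i))" for i
  proof -
    let ?t = "teichmueller c * teichmueller d"
    have "cong_pf (Suc (a i)) (teichmueller c' * teichmueller d) ?t"
      by (intro cong_mod_mult teichmueller_cong) (simp_all add: c)
    then have d': "cong_pf (Suc (a i)) (teichmueller c' * teichmueller d) 1"
      using d by (rule cong_mod_trans)
    have "cong_pf (Suc (a i)) (?t * unit_prod (e i)) (teichmueller c' * teichmueller d * unit_prod (e' i))"
      using cong_mod_mult_left[OF i[of i], of "teichmueller d"] by (simp add: lift_def mult_ac)
    moreover have "cong_pf (Suc (a i)) (?t * unit_prod (e i)) (1 * unit_prod (e i))"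
      by (rule cong_mod_mult[OF d cong_mod_refl])
    moreover have "cong_pf (Suc (a i)) (teichmueller c' * teichmueller d * unit_prod (e' i)) (1 * unit_prod (e' i))"
      by (rule cong_mod_mult[OF d' cong_mod_refl])
    ultimately show ?thesis
      unfolding mult_1 by (blast intro: cong_mod_trans cong_mod_sym)
  qed
  with c show "x [^] c = x [^] c' \<and> (\<forall>i. \<forall>j<l. [e i j = e' i j] (mod p ^ a i))"
    by (simp add: unit_prod_cong_iff)
next
  assume "x [^] c = x [^] c' \<and> (\<forall>i. \<forall>j<l. [e i j = e' i j] (mod p ^ a i))"
  then show "lift (c, e) - lift (c', e') \<in> fibre_ideal"
    unfolding diff_in_fibre_ideal lift_def
    by (auto intro!: cong_mod_mult teichmueller_cong simp: unit_prod_cong_iff)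
qed

lemma ex_lift:
  assumes u: "u \<in> fibre" and "phi (u 0) \<noteq> \<zero>"
  shows "\<exists>z. u - lift z \<in> fibre_ideal"
proof -
  have "phi (u 0) \<in> carrier F - {\<zero>}" using assms by simp
  then obtain c :: nat where c: "phi (u 0) = x [^] c" unfolding generator by blast
  obtain d where d: "x [^] c \<otimes> x [^] d = \<one>" "\<And>i. cong_pf (Suc (a i)) (teichmueller c * teichmueller d) 1"
    using teichmueller_inverse[of c] by blast
  have "cong_pf 1 (u i * teichmueller d) 1" for i
    using fibreD[OF u, of i] c d(1) by (simp flip: phi_eq_iff del: One_nat_def)
  then have "\<forall>i. \<exists>e. cong_pf (Suc (a i)) (u i * teichmueller d) (unit_prod e)"
    using unit_prod_surj by blast
  then obtain e where e: "\<And>i. cong_pf (Suc (a i)) (u i * teichmueller d) (unit_prod (e i))" by metis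
  have "cong_pf (Suc (a i)) (u i) (lift (c, e) i)" for i
  proof -
    have "cong_pf (Suc (a i)) (u i * (teichmueller c * teichmueller d)) (u i * 1)"
      using d(2) by (rule cong_mod_mult_left)
    moreover have "cong_pf (Suc (a i)) (teichmueller c * (u i * teichmueller d)) (teichmueller c * unit_prod (e i))"
      using e by (rule cong_mod_mult_left)
    ultimately show ?thesis
      unfolding lift_def by (simp add: mult_ac) (blast intro: cong_mod_trans cong_mod_sym)
  qed
  then show ?thesis unfolding diff_in_fibre_ideal by blast
qed

lemma phi_diff_fibre_ideal: "u - v \<in> fibre_ideal \<Longrightarrow> phi (u i) = phi (v i)"
  using fibre_ideal_phi[of "u - v" i] by simp

text \<open>If a finite group \<open>H\<close> is an image of the monoid of exponents with the same kernel relation as \<open>lift\<close>,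
  then it is the unit group of the fibre product. Finiteness of the ring comes from that of \<open>H\<close>: an
  element with nonzero residue is a unit, and otherwise it becomes a unit after adding \<open>1\<close>.\<close>

lemma ex_local_ring:
  fixes H :: "('h, 'm) monoid_scheme" and g :: "nat \<times> (nat \<Rightarrow> nat \<Rightarrow> nat) \<Rightarrow> 'h"
  assumes H: "group H" "finite (carrier H)"
    and g: "range g = carrier H" "\<And>y z. g (exp_add y z) = g y \<otimes>\<^bsub>H\<^esub> g z"
    and g_eq_iff: "\<And>y z. g y = g z \<longleftrightarrow> lift y - lift z \<in> fibre_ideal"
  shows "\<exists>A :: nat ring. local_ring A \<and> artinian_ring A \<and> units_of A \<cong> H"
proof -
  interpret H: group H by (rule H)
  \<comment> \<open>One lift for each element of \<open>H\<close>; together with their translates by \<open>-1\<close> they meet every class.\<close>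
  define s where "s b = lift (SOME z. g z = b)" for b
  have s: "lift z - s (g z) \<in> fibre_ideal" for z
    unfolding s_def g_eq_iff[symmetric] by (rule someI2[of _ z]) auto
  define T where "T = s ` carrier H \<union> (\<lambda>u. u - 1) ` s ` carrier H"
  have "finite T" using H(2) by (simp add: T_def)
  have sub_trans: "u - w \<in> fibre_ideal" if "u - v \<in> fibre_ideal" "v - w \<in> fibre_ideal" for u v w
    using that unfolding diff_in_fibre_ideal by (blast intro: cong_mod_trans)
  have T: "\<exists>t\<in>T. u - t \<in> fibre_ideal" if u: "u \<in> fibre" for u
  proof (cases "phi (u 0) = \<zero>")
    case False
    then obtain z where z: "u - lift z \<in> fibre_ideal" using ex_lift[OF u] by blast
    then have "u - s (g z) \<in> fibre_ideal" using s by (rule sub_trans)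
    moreover have "s (g z) \<in> T" using g(1) by (auto simp: T_def)
    ultimately show ?thesis by blast
  next
    case True
    have "u + 1 \<in> fibre" "phi ((u + 1) 0) \<noteq> \<zero>"
      using u True by (simp_all add: fibre_add fibre_1)
    then obtain z where z: "u + 1 - lift z \<in> fibre_ideal" using ex_lift by blast
    then have "u + 1 - s (g z) \<in> fibre_ideal" using s by (rule sub_trans)
    then have "u - (s (g z) - 1) \<in> fibre_ideal" by (simp add: algebra_simps)
    moreover have "s (g z) - 1 \<in> T" using g(1) by (auto simp: T_def)
    ultimately show ?thesis by blast
  qed
  obtain A :: "nat ring" and h :: "(nat \<Rightarrow> int poly) \<Rightarrow> nat"
    where A: "cring A" "finite (carrier A)" and h: "h ` fibre = carrier A"
      "\<And>u v. u \<in> fibre \<Longrightarrow> v \<in> fibre \<Longrightarrow> h (u + v) = h u \<oplus>\<^bsub>A\<^esub> h v"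
      "\<And>u v. u \<in> fibre \<Longrightarrow> v \<in> fibre \<Longrightarrow> h (u * v) = h u \<otimes>\<^bsub>A\<^esub> h v"
      "h 1 = \<one>\<^bsub>A\<^esub>" "h 0 = \<zero>\<^bsub>A\<^esub>"
    and h_eq: "\<And>u v. u \<in> fibre \<Longrightarrow> v \<in> fibre \<Longrightarrow> h u = h v \<longleftrightarrow> u - v \<in> fibre_ideal"
  proof (rule ex_finite_quotient_ring[of fibre fibre_ideal T])
    show "fibre_ideal \<subseteq> fibre" using fibre_ideal_phi by (auto simp: fibre_def)
    show "u - v \<in> fibre_ideal" if "u \<in> fibre_ideal" "v \<in> fibre_ideal" for u v
      using that unfolding diff_in_fibre_ideal
      by (auto simp: fibre_ideal_def intro: cong_mod_trans[OF _ cong_mod_sym])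
    show "u * v \<in> fibre_ideal" if "v \<in> fibre_ideal" for u v
      using that cong_mod_mult_left[of f p _ _ 0] by (force simp: fibre_ideal_def)
  qed (use \<open>finite T\<close> T fibre_1 fibre_diff fibre_mult in \<open>auto simp: fibre_ideal_def\<close>)
  interpret A: cring A by (rule A)
  have h_closed: "h u \<in> carrier A" if "u \<in> fibre" for u using h(1) that by blast
  have unit_lift: "h (lift z) \<in> Units A" for z
  proof -
    have "inv\<^bsub>H\<^esub> (g z) \<in> range g" using g(1) by auto
    then obtain y where y: "inv\<^bsub>H\<^esub> (g z) = g y" by blast
    let ?z0 = "(0, \<lambda>i j. 0) :: nat \<times> (nat \<Rightarrow> nat \<Rightarrow> nat)"
    have gz: "g z \<in> carrier H" for z using g(1) by blast
    have "exp_add ?z0 ?z0 = ?z0" by (simp add: exp_add_def)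
    then have "g ?z0 \<otimes>\<^bsub>H\<^esub> g ?z0 = g ?z0" using g(2)[of ?z0 ?z0] by simp
    then have "g ?z0 = \<one>\<^bsub>H\<^esub>" using gz[of ?z0] by simp
    then have "g (exp_add z y) = g ?z0" using gz by (simp add: g(2) flip: y)
    then have "lift z * lift y - 1 \<in> fibre_ideal" by (simp add: g_eq_iff lift_exp_add lift_0)
    moreover have "lift z * lift y \<in> fibre" "1 \<in> fibre"
      using lift_in_fibre[of "exp_add z y"] lift_in_fibre[of ?z0] by (simp_all add: lift_exp_add lift_0)
    ultimately have "h (lift z) \<otimes>\<^bsub>A\<^esub> h (lift y) = \<one>\<^bsub>A\<^esub>"
      using h_eq h(3)[OF lift_in_fibre lift_in_fibre] h(4) by metis
    moreover have hc: "h (lift z) \<in> carrier A" "h (lift y) \<in> carrier A"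
      by (intro h_closed lift_in_fibre)+
    ultimately show ?thesis
      using A.m_comm[OF hc] unfolding Units_def by auto
  qed
  have unit: "h u \<in> Units A \<longleftrightarrow> phi (u 0) \<noteq> \<zero>" if u: "u \<in> fibre" for u
  proof
    assume "phi (u 0) \<noteq> \<zero>"
    then obtain z where "u - lift z \<in> fibre_ideal" using ex_lift[OF u] by blast
    then have "h u = h (lift z)" using h_eq[OF u lift_in_fibre] by simp
    then show "h u \<in> Units A" using unit_lift by simp
  next
    assume "h u \<in> Units A"
    then obtain y where "y \<in> h ` fibre" "h u \<otimes>\<^bsub>A\<^esub> y = \<one>\<^bsub>A\<^esub>"
      unfolding h(1) by (auto simp: Units_def)
    then obtain v where v: "v \<in> fibre" "h u \<otimes>\<^bsub>A\<^esub> h v = \<one>\<^bsub>A\<^esub>" by auto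
    have "u * v \<in> fibre" "1 \<in> fibre" using u v fibre_mult fibre_1 by simp_all
    then have "u * v - 1 \<in> fibre_ideal"
      using h_eq[of "u * v" 1] h(3)[OF u v(1)] h(4) v(2) by simp
    then have "phi (u 0) \<otimes> phi (v 0) = \<one>" using phi_diff_fibre_ideal[of "u * v" 1 0] by simp
    then show "phi (u 0) \<noteq> \<zero>" by auto
  qed
  have "Units A = range (\<lambda>z. h (lift z))"
  proof
    show "Units A \<subseteq> range (\<lambda>z. h (lift z))"
    proof
      fix y assume y: "y \<in> Units A"
      then have "y \<in> h ` fibre" unfolding h(1) by (rule A.Units_closed)
      then obtain u where u: "u \<in> fibre" "y = h u" by blast
      then obtain z where "u - lift z \<in> fibre_ideal" using ex_lift[OF u(1)] unit[OF u(1)] y by blast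
      then show "y \<in> range (\<lambda>z. h (lift z))" using h_eq[OF u(1) lift_in_fibre] u(2) by auto
    qed
  qed (use unit_lift in auto)
  then have "units_of A \<cong> H"
    using g g_eq_iff
    by (intro iso_of_common_cover[of "\<lambda>z. h (lift z)" _ exp_add g])
      (auto simp: units_of_carrier units_of_mult lift_exp_add h(3) lift_in_fibre h_eq)
  moreover have "artinian_ring A" using A(2) by (rule A.finite_imp_artinian)
  moreover have "local_ring A"
  proof (rule A.local_ringI)
    define M where "M = h ` {u \<in> fibre. phi (u 0) = \<zero>}"
    have M_iff: "h u \<in> M \<longleftrightarrow> phi (u 0) = \<zero>" if "u \<in> fibre" for u
      using that h_eq phi_diff_fibre_ideal by (fastforce simp: M_def)
    have neg: "\<ominus>\<^bsub>A\<^esub> h u = h (- u)" if "u \<in> fibre" for u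
    proof (rule A.minus_equality)
      have "- u \<in> fibre" using that by (rule fibre_uminus)
      then show "h (- u) \<in> carrier A" "h (- u) \<oplus>\<^bsub>A\<^esub> h u = \<zero>\<^bsub>A\<^esub>"
        using h_closed that h(2)[of "- u" u] h(5) by simp_all
    qed (use h_closed that in simp)
    show "ideal M A"
    proof (rule idealI[OF A.ring_axioms])
      show "subgroup M (add_monoid A)"
      proof (rule group.subgroupI[OF A.add.is_group])
        show "M \<subseteq> carrier (add_monoid A)" using h_closed by (auto simp: M_def)
        have "h 0 \<in> M" using fibre_0 by (auto simp: M_def)
        then show "M \<noteq> {}" by blast
        fix y z assume "y \<in> M" "z \<in> M"
        then obtain u v where uv: "y = h u" "z = h v" "u \<in> fibre" "v \<in> fibre"
            "phi (u 0) = \<zero>" "phi (v 0) = \<zero>" by (auto simp: M_def)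
        then have "u + v \<in> fibre" "phi ((u + v) 0) = \<zero>" using fibre_add by simp_all
        then have "h (u + v) \<in> M" using M_iff by blast
        then show "y \<otimes>\<^bsub>add_monoid A\<^esub> z \<in> M" by (simp add: uv(1,2) h(2)[OF uv(3,4)])
        have "- u \<in> fibre" "phi ((- u) 0) = \<zero>"
          using uv by (simp_all add: fibre_uminus phi_uminus)
        then have "h (- u) \<in> M" using M_iff by blast
        then show "inv\<^bsub>add_monoid A\<^esub> y \<in> M" using neg[OF uv(3)] by (simp add: uv(1) a_inv_def)
      qed
      fix y z assume "y \<in> M" "z \<in> carrier A"
      then obtain u v where uv: "y = h u" "z = h v" "u \<in> fibre" "v \<in> fibre" "phi (u 0) = \<zero>"
        unfolding h(1)[symmetric] by (auto simp: M_def)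
      then have "v * u \<in> fibre" "phi ((v * u) 0) = \<zero>" using fibre_mult by simp_all
      then have "h (v * u) \<in> M" using M_iff by blast
      then show "z \<otimes>\<^bsub>A\<^esub> y \<in> M" by (simp add: uv(1,2) h(3)[OF uv(4,3)])
      then show "y \<otimes>\<^bsub>A\<^esub> z \<in> M"
        using A.m_comm[OF h_closed[OF uv(3)] h_closed[OF uv(4)]] by (simp add: uv(1,2))
    qed
    show "\<one>\<^bsub>A\<^esub> \<notin> M" using M_iff[OF fibre_1] h(4) by simp
    show "carrier A - M \<subseteq> Units A" unfolding h(1)[symmetric] using unit M_iff by auto
  qed
  ultimately show ?thesis by blast
qed

end

section \<open>The local ring with prescribed unit group\<close>

theorem proposition4p3:
  fixes p l :: nat and P :: "('a, 'b) monoid_scheme"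
  assumes "Factorial_Ring.prime p" and "p > 2" and "l \<ge> 1"
    and "comm_group P" and "finite (carrier P)" and "\<exists>k. order P = p ^ k"
  shows "\<exists>A :: nat ring. local_ring A \<and> artinian_ring A \<and>
           units_of A \<cong> units_of (GF (p ^ l)) \<times>\<times> product_group {..<l} (\<lambda>_. P)"
proof -
  define F where "F = GF (p ^ l)"
  have l: "l > 0" using \<open>l \<ge> 1\<close> by simp
  have F: "field F" "finite (carrier F)" "Coset.order F = p ^ l"
    using GF_prime_power[OF assms(1) l] by (simp_all add: F_def)
  interpret F: field F by (rule F)
  obtain x f where x: "x \<in> carrier F" and gen: "carrier F - {\<zero>\<^bsub>F\<^esub>} = range (\<lambda>i::nat. x [^]\<^bsub>F\<^esub> i)"
    and x_q: "x [^]\<^bsub>F\<^esub> (p ^ l) = x"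
    and f: "Polynomial.lead_coeff f = 1" "Polynomial.degree f = l"
    and ker: "\<And>b. F.int_poly_eval x b = \<zero>\<^bsub>F\<^esub> \<longleftrightarrow> (\<exists>c d. b = of_nat p * c + f * d)"
    by (rule F.int_poly_presentation[OF assms(1) l F(3)]) (rule that)
  interpret P: comm_group P by (rule assms(4))
  obtain k where k: "Coset.order P = p ^ k" using assms(6) by blast
  obtain m :: nat and g :: "nat \<Rightarrow> 'a" and a :: "nat \<Rightarrow> nat"
    where g: "g \<in> {..<m} \<rightarrow> carrier P" and a0: "\<And>i. i \<ge> m \<Longrightarrow> a i = 0"
    and surj: "\<And>y. y \<in> carrier P \<Longrightarrow> \<exists>c :: nat \<Rightarrow> nat. y = (\<Otimes>\<^bsub>P\<^esub>i\<in>{..<m}. g i [^]\<^bsub>P\<^esub> c i)"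
    and rel: "\<And>c d :: nat \<Rightarrow> nat. (\<Otimes>\<^bsub>P\<^esub>i\<in>{..<m}. g i [^]\<^bsub>P\<^esub> c i) = (\<Otimes>\<^bsub>P\<^esub>i\<in>{..<m}. g i [^]\<^bsub>P\<^esub> d i)
      \<longleftrightarrow> (\<forall>i<m. [c i = d i] (mod p ^ a i))"
    by (rule P.finite_p_group_basis[OF assms(1) assms(5) k]) (rule that)
  \<comment> \<open>A multiple of \<open>l\<close>, so that \<open>x ^ (p ^ N) = x\<close>, and an upper bound of all \<open>a i\<close>.\<close>
  define N where "N = l * (\<Sum>i<m. a i)"
  have "a i \<le> N" for i
  proof (cases "i < m")
    case True
    then have "a i \<le> (\<Sum>i<m. a i)" by (intro member_le_sum) auto
    also have "\<dots> \<le> N" using l by (simp add: N_def)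
    finally show ?thesis .
  qed (simp add: a0)
  have "x [^]\<^bsub>F\<^esub> (p ^ (l * n)) = x" for n
  proof (induction n)
    case 0
    then show ?case using x by simp
  next
    case (Suc n)
    then show ?case using x_q x by (simp add: power_add mult.commute flip: F.nat_pow_pow)
  qed
  then have frob: "x [^]\<^bsub>F\<^esub> (p ^ N) = x" by (simp add: N_def)
  have "odd p" using assms(1,2) prime_odd_nat by blast
  interpret residue_presentation f p l F x a N
    by unfold_locales (use f l \<open>odd p\<close> \<open>p > 2\<close> x gen ker frob \<open>\<And>i. a i \<le> N\<close> in auto)
  let ?H = "units_of F \<times>\<times> product_group {..<l} (\<lambda>_. P)"
  define b :: "nat \<times> (nat \<Rightarrow> nat \<Rightarrow> nat) \<Rightarrow> _" where
    "b = (\<lambda>(c, e). (x [^]\<^bsub>F\<^esub> c, \<lambda>j\<in>{..<l}. \<Otimes>\<^bsub>P\<^esub>i\<in>{..<m}. g i [^]\<^bsub>P\<^esub> e i j))"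
  have units: "carrier (units_of F) = range (\<lambda>c::nat. x [^]\<^bsub>F\<^esub> c)"
    by (simp add: units_of_carrier F.field_Units gen)
  have prod_closed: "(\<Otimes>\<^bsub>P\<^esub>i\<in>{..<m}. g i [^]\<^bsub>P\<^esub> (c i :: nat)) \<in> carrier P" for c
    using g by (intro P.finprod_closed) auto
  have "\<exists>A :: nat ring. local_ring A \<and> artinian_ring A \<and> units_of A \<cong> ?H"
  proof (rule ex_local_ring)
    show "group ?H" by (intro DirProd_group F.units_group product_group) (rule P.is_group)
    show "finite (carrier ?H)"
      using F(2) assms(5) by (auto simp: units_of_carrier F.field_Units intro!: finite_PiE)
    show "b (exp_add y z) = b y \<otimes>\<^bsub>?H\<^esub> b z" for y z
      using x by (auto simp: b_def exp_add_def units_of_mult F.nat_pow_mult P.finprod_nat_pow_add[OF g]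
        split: prod.splits)
    show "b y = b z \<longleftrightarrow> lift y - lift z \<in> fibre_ideal" for y z
    proof (cases y; cases z)
      fix c e c' e' assume y: "y = (c, e)" and z: "z = (c', e')"
      have "b y = b z \<longleftrightarrow> x [^]\<^bsub>F\<^esub> c = x [^]\<^bsub>F\<^esub> c' \<and>
        (\<forall>j<l. \<forall>i<m. [e i j = e' i j] (mod p ^ a i))"
        unfolding y z b_def by (auto simp: restrict_def fun_eq_iff rel)
      also have "\<dots> \<longleftrightarrow> lift y - lift z \<in> fibre_ideal"
        unfolding y z lift_cong_iff using a0 by (metis cong_1 leI power_0)
      finally show ?thesis .
    qed
    show "range b = carrier ?H"
    proof
      show "range b \<subseteq> carrier ?H" using prod_closed by (auto simp: b_def units split: if_splits)
      show "carrier ?H \<subseteq> range b"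
      proof
        fix w assume "w \<in> carrier ?H"
        then obtain y h where w: "w = (y, h)" "y \<in> range (\<lambda>c::nat. x [^]\<^bsub>F\<^esub> c)"
          and h: "h \<in> {..<l} \<rightarrow>\<^sub>E carrier P" by (auto simp: units)
        then obtain c :: nat where c: "y = x [^]\<^bsub>F\<^esub> c" by blast
        have "\<forall>j\<in>{..<l}. \<exists>c :: nat \<Rightarrow> nat. h j = (\<Otimes>\<^bsub>P\<^esub>i\<in>{..<m}. g i [^]\<^bsub>P\<^esub> c i)"
          using surj h by blast
        then obtain e :: "nat \<Rightarrow> nat \<Rightarrow> nat" where
          e: "\<And>j. j < l \<Longrightarrow> h j = (\<Otimes>\<^bsub>P\<^esub>i\<in>{..<m}. g i [^]\<^bsub>P\<^esub> e j i)"
          unfolding bchoice_iff by blast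
        have "h = (\<lambda>j\<in>{..<l}. \<Otimes>\<^bsub>P\<^esub>i\<in>{..<m}. g i [^]\<^bsub>P\<^esub> e j i)"
        proof (rule ext)
          fix j
          show "h j = (\<lambda>j\<in>{..<l}. \<Otimes>\<^bsub>P\<^esub>i\<in>{..<m}. g i [^]\<^bsub>P\<^esub> e j i) j"
          proof (cases "j < l")
            case True
            then show ?thesis using e[OF True] by simp
          next
            case False
            then show ?thesis using PiE_arb[OF h] by simp
          qed
        qed
        then have "w = b (c, \<lambda>i j. e j i)" unfolding w(1) c b_def by simp
        then show "w \<in> range b" by blast
      qed
    qed
  qed
  then show ?thesis unfolding F_def .
qed

end
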